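(* The scalar curvature of a Kähler toric manifold can be written in the symplectic coordinates $(x,\phi)$ as $$S=-\frac{1}{\det(h)}\sum_{i,j=1}^n h_{ij}\,\frac{\partial^2\det(h)}{\partial x_i\,\partial x_j}.$$
   Context: A Kähler toric manifold is a Kähler manifold $(M^{2n},J,\omega)$ with a smooth Hamiltonian $T^n$-action preserving the Kähler structure. On the open dense set where the action is free there are symplectic (Darboux) coordinates $(x_1,\dots,x_n,\phi_1,\dots,\phi_n)$, where $x$ is the moment map and $\phi$ are angular coordinates on $T^n$, in which $\omega=\sum dx_i\wedge d\phi_i$ and $$g=\sum_{i,j}h^{ij}\,dx_i\,dx_j+\sum_{i,j}h_{ij}\,d\phi_i\,d\phi_j,$$ where $h=(h_{ij}(x_1,\dots,x_n))$ is symmetric positive definite, $(h^{ij})=h^{-1}$, and $h^{ij}=\frac{\partial^2\Phi}{\partial x_i\partial x_j}$ for a function $\Phi=\Phi(x_1,\dots,x_n)$ (the symplectic potential). *)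

theory Defs
  imports "HOL-Analysis.Analysis"
begin

section \<open>Calculus on open subsets of Euclidean space\<close>

text \<open>These notions are only meant for open sets \<open>S\<close>: differentiability is two-sided.\<close>

primrec Ck_on :: "nat \<Rightarrow> 'a::real_normed_vector set \<Rightarrow> ('a \<Rightarrow> 'b::real_normed_vector) \<Rightarrow> bool" where
  "Ck_on 0 S f \<longleftrightarrow> continuous_on S f"
| "Ck_on (Suc k) S f \<longleftrightarrow>
     (\<forall>x\<in>S. f differentiable at x) \<and> (\<forall>v. Ck_on k S (\<lambda>x. frechet_derivative f (at x) v))"

definition smooth_on :: "'a::real_normed_vector set \<Rightarrow> ('a \<Rightarrow> 'b::real_normed_vector) \<Rightarrow> bool" where
  "smooth_on S f \<longleftrightarrow> (\<forall>k. Ck_on k S f)"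

definition partial :: "'k::finite \<Rightarrow> (real^'k \<Rightarrow> real) \<Rightarrow> real^'k \<Rightarrow> real" where
  "partial i f x = frechet_derivative f (at x) (axis i 1)"

definition symmetric_mat :: "real^'k^'k \<Rightarrow> bool" where
  "symmetric_mat M \<longleftrightarrow> transpose M = M"

definition pos_definite :: "real^'k^'k \<Rightarrow> bool" where
  "pos_definite M \<longleftrightarrow> (\<forall>v. v \<noteq> 0 \<longrightarrow> v \<bullet> (M *v v) > 0)"


section \<open>Curvature of a metric given by its components in coordinates\<close>

definition christoffel :: "(real^'d \<Rightarrow> real^'d^'d) \<Rightarrow> 'd::finite \<Rightarrow> 'd \<Rightarrow> 'd \<Rightarrow> real^'d \<Rightarrow> real" where
  "christoffel G k i j y =
     (1/2) * (\<Sum>l\<in>UNIV. matrix_inv (G y) $ k $ l *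
        (partial i (\<lambda>z. G z $ j $ l) y + partial j (\<lambda>z. G z $ i $ l) y - partial l (\<lambda>z. G z $ i $ j) y))"

text \<open>\<open>riemann G l k i j\<close> is the coefficient \<open>R\<^sup>l\<^sub>k\<^sub>i\<^sub>j\<close> in
  \<open>R(\<partial>\<^sub>i, \<partial>\<^sub>j) \<partial>\<^sub>k = R\<^sup>l\<^sub>k\<^sub>i\<^sub>j \<partial>\<^sub>l\<close>, where
  \<open>R(X,Y) = \<nabla>\<^sub>X \<nabla>\<^sub>Y - \<nabla>\<^sub>Y \<nabla>\<^sub>X - \<nabla>\<^bsub>[X,Y]\<^esub>\<close>. With these signs round spheres have positive
  scalar curvature, and in dimension two the scalar curvature is twice the Gauss curvature.\<close>

definition riemann ::
  "(real^'d \<Rightarrow> real^'d^'d) \<Rightarrow> 'd::finite \<Rightarrow> 'd \<Rightarrow> 'd \<Rightarrow> 'd \<Rightarrow> real^'d \<Rightarrow> real" where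
  "riemann G l k i j y =
     partial i (christoffel G l j k) y - partial j (christoffel G l i k) y
     + (\<Sum>m\<in>UNIV. christoffel G l i m y * christoffel G m j k y
                 - christoffel G l j m y * christoffel G m i k y)"

definition ricci :: "(real^'d \<Rightarrow> real^'d^'d) \<Rightarrow> 'd::finite \<Rightarrow> 'd \<Rightarrow> real^'d \<Rightarrow> real" where
  "ricci G j k y = (\<Sum>i\<in>UNIV. riemann G i k i j y)"

definition scalar_curvature_coords :: "(real^'d \<Rightarrow> real^'d::finite^'d) \<Rightarrow> real^'d \<Rightarrow> real" where
  "scalar_curvature_coords G y =
     (\<Sum>j\<in>UNIV. \<Sum>k\<in>UNIV. matrix_inv (G y) $ j $ k * ricci G j k y)"


section \<open>Smooth manifolds and tensor fields\<close>

type_synonym ('m, 'd) chart = "'m set \<times> ('m \<Rightarrow> real^'d)"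

abbreviation chart_dom :: "('m, 'd) chart \<Rightarrow> 'm set" where
  "chart_dom c \<equiv> fst c"

abbreviation chart_map :: "('m, 'd) chart \<Rightarrow> 'm \<Rightarrow> real^'d" where
  "chart_map c \<equiv> snd c"

definition chart_image :: "('m, 'd) chart \<Rightarrow> (real^'d) set" where
  "chart_image c = chart_map c ` chart_dom c"

definition chart_inv :: "('m, 'd) chart \<Rightarrow> real^'d \<Rightarrow> 'm" where
  "chart_inv c = inv_into (chart_dom c) (chart_map c)"

definition is_chart :: "'m topology \<Rightarrow> ('m, 'd::finite) chart \<Rightarrow> bool" where
  "is_chart X c \<longleftrightarrow> openin X (chart_dom c) \<and> open (chart_image c) \<and>
     homeomorphic_map (subtopology X (chart_dom c)) (top_of_set (chart_image c)) (chart_map c)"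

definition in_charts :: "('m, 'd) chart \<Rightarrow> ('m, 'd) chart \<Rightarrow> ('m \<Rightarrow> 'm) \<Rightarrow> real^'d \<Rightarrow> real^'d" where
  "in_charts c c' F y = chart_map c' (F (chart_inv c y))"

definition jac :: "('m, 'd::finite) chart \<Rightarrow> ('m, 'd) chart \<Rightarrow> ('m \<Rightarrow> 'm) \<Rightarrow> 'm \<Rightarrow> real^'d^'d" where
  "jac c c' F p = jacobian (in_charts c c' F) (at (chart_map c p))"

definition compatible_charts :: "('m, 'd::finite) chart \<Rightarrow> ('m, 'd) chart \<Rightarrow> bool" where
  "compatible_charts c c' \<longleftrightarrow>
     smooth_on (chart_map c ` (chart_dom c \<inter> chart_dom c')) (in_charts c c' id) \<and>
     smooth_on (chart_map c' ` (chart_dom c \<inter> chart_dom c')) (in_charts c' c id)"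

locale smooth_manifold =
  fixes X :: "'m topology" and A :: "('m, 'd::finite) chart set"
  assumes Hausdorff: "Hausdorff_space X"
    and second_countable: "second_countable X"
    and charts: "c \<in> A \<Longrightarrow> is_chart X c"
    and cover: "(\<Union>c\<in>A. chart_dom c) = topspace X"
    and compatible: "c \<in> A \<Longrightarrow> c' \<in> A \<Longrightarrow> compatible_charts c c'"
    and maximal: "is_chart X c \<Longrightarrow> (\<And>c'. c' \<in> A \<Longrightarrow> compatible_charts c c') \<Longrightarrow> c \<in> A"

text \<open>A tensor field of rank two assigns to a chart \<open>c\<close> and a point \<open>p\<close> of its domain the matrix of
  components in the coordinate frame of \<open>c\<close>, subject to the transformation law for its type. For a
  covariant field \<open>T\<close> the entry \<open>(i,j)\<close> is \<open>T(\<partial>\<^sub>i, \<partial>\<^sub>j)\<close>; for a field of endomorphisms \<open>T\<close> the entry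
  \<open>(i,j)\<close> is the coefficient of \<open>\<partial>\<^sub>i\<close> in \<open>T \<partial>\<^sub>j\<close>.\<close>

type_synonym ('m, 'd) tensor2 = "('m, 'd) chart \<Rightarrow> 'm \<Rightarrow> real^'d^'d"

definition smooth_components :: "('m, 'd::finite) chart set \<Rightarrow> ('m, 'd) tensor2 \<Rightarrow> bool" where
  "smooth_components A T \<longleftrightarrow> (\<forall>c\<in>A. smooth_on (chart_image c) (\<lambda>y. T c (chart_inv c y)))"

definition covariant_field :: "('m, 'd::finite) chart set \<Rightarrow> ('m, 'd) tensor2 \<Rightarrow> bool" where
  "covariant_field A T \<longleftrightarrow> smooth_components A T \<and>
     (\<forall>c\<in>A. \<forall>c'\<in>A. \<forall>p \<in> chart_dom c \<inter> chart_dom c'.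
        T c p = transpose (jac c c' id p) ** T c' p ** jac c c' id p)"

definition endomorphism_field :: "('m, 'd::finite) chart set \<Rightarrow> ('m, 'd) tensor2 \<Rightarrow> bool" where
  "endomorphism_field A T \<longleftrightarrow> smooth_components A T \<and>
     (\<forall>c\<in>A. \<forall>c'\<in>A. \<forall>p \<in> chart_dom c \<inter> chart_dom c'.
        jac c c' id p ** T c p = T c' p ** jac c c' id p)"

locale riemannian_manifold = smooth_manifold X A
  for X :: "'m topology" and A :: "('m, 'd::finite) chart set" +
  fixes g :: "('m, 'd) tensor2"
  assumes metric_field: "covariant_field A g"
    and metric_sym: "c \<in> A \<Longrightarrow> p \<in> chart_dom c \<Longrightarrow> symmetric_mat (g c p)"
    and metric_pos: "c \<in> A \<Longrightarrow> p \<in> chart_dom c \<Longrightarrow> pos_definite (g c p)"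

text \<open>The scalar curvature at \<open>p\<close>, computed in the coordinates of \<open>c\<close>; as a full contraction of
  the curvature tensor it is the same number for every chart around \<open>p\<close>.\<close>

definition scalar_curvature :: "('m, 'd::finite) tensor2 \<Rightarrow> ('m, 'd) chart \<Rightarrow> 'm \<Rightarrow> real" where
  "scalar_curvature g c p = scalar_curvature_coords (\<lambda>y. g c (chart_inv c y)) (chart_map c p)"

definition closed_2form :: "('m, 'd::finite) chart set \<Rightarrow> ('m, 'd) tensor2 \<Rightarrow> bool" where
  "closed_2form A \<omega> \<longleftrightarrow> covariant_field A \<omega> \<and>
     (\<forall>c\<in>A. \<forall>p\<in>chart_dom c. transpose (\<omega> c p) = - \<omega> c p \<and>
        (\<forall>i j k. partial i (\<lambda>y. \<omega> c (chart_inv c y) $ j $ k) (chart_map c p)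
               + partial j (\<lambda>y. \<omega> c (chart_inv c y) $ k $ i) (chart_map c p)
               + partial k (\<lambda>y. \<omega> c (chart_inv c y) $ i $ j) (chart_map c p) = 0))"


section \<open>Kaehler manifolds\<close>

text \<open>Real dimension \<open>2n\<close> is rendered by the index type \<^typ>\<open>'n + 'n\<close>.\<close>

definition block :: "real^'n^'n \<Rightarrow> real^'n^'n \<Rightarrow> real^'n^'n \<Rightarrow> real^'n^'n \<Rightarrow> real^('n + 'n)^('n + 'n)" where
  "block P Q R S = (\<chi> i j.
     case i of
       Inl a \<Rightarrow> (case j of Inl b \<Rightarrow> P $ a $ b | Inr b \<Rightarrow> Q $ a $ b)
     | Inr a \<Rightarrow> (case j of Inl b \<Rightarrow> R $ a $ b | Inr b \<Rightarrow> S $ a $ b))"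

text \<open>A chart with \<open>J \<partial>\<^sub>u\<^sub>a = \<partial>\<^sub>v\<^sub>a\<close> and \<open>J \<partial>\<^sub>v\<^sub>a = - \<partial>\<^sub>u\<^sub>a\<close> amounts to holomorphic coordinates \<open>u\<^sub>a + i v\<^sub>a\<close>.\<close>

definition holomorphic_chart :: "('m, 'n::finite + 'n) tensor2 \<Rightarrow> ('m, 'n + 'n) chart \<Rightarrow> bool" where
  "holomorphic_chart J c \<longleftrightarrow> (\<forall>p\<in>chart_dom c. J c p = block 0 (- mat 1) (mat 1) 0)"

text \<open>The sign convention is \<open>\<omega>(u,v) = g(J u, v)\<close>. Nondegeneracy of \<open>\<omega>\<close> is a consequence.\<close>

locale kahler_manifold = riemannian_manifold X A g
  for X :: "'m topology" and A :: "('m, 'n::finite + 'n) chart set" and g :: "('m, 'n + 'n) tensor2" +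
  fixes J \<omega> :: "('m, 'n + 'n) tensor2"
  assumes complex_field: "endomorphism_field A J"
    and complex_square: "c \<in> A \<Longrightarrow> p \<in> chart_dom c \<Longrightarrow> J c p ** J c p = - mat 1"
    and complex_integrable: "p \<in> topspace X \<Longrightarrow> \<exists>c\<in>A. p \<in> chart_dom c \<and> holomorphic_chart J c"
    and hermitian: "c \<in> A \<Longrightarrow> p \<in> chart_dom c \<Longrightarrow> transpose (J c p) ** g c p ** J c p = g c p"
    and kahler_form: "c \<in> A \<Longrightarrow> p \<in> chart_dom c \<Longrightarrow> \<omega> c p = transpose (J c p) ** g c p"
    and symplectic: "closed_2form A \<omega>"


section \<open>Kaehler toric manifolds and symplectic coordinates\<close>

text \<open>The torus is \<open>\<real>\<^sup>n / (2\<pi>\<int>)\<^sup>n\<close>; its actions are the actions of \<open>\<real>\<^sup>n\<close> in which the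
  lattice acts trivially.\<close>

definition torus_lattice :: "(real^'n) set" where
  "torus_lattice = {t. \<forall>i. \<exists>k::int. t $ i = 2 * pi * of_int k}"

definition generator :: "(real^'n \<Rightarrow> 'm \<Rightarrow> 'm) \<Rightarrow> ('m, 'd::finite) chart \<Rightarrow> 'n::finite \<Rightarrow> 'm \<Rightarrow> real^'d" where
  "generator act c i p = vector_derivative (\<lambda>s. chart_map c (act (s *\<^sub>R axis i 1) p)) (at 0)"

locale kahler_toric_manifold = kahler_manifold X A g J \<omega>
  for X :: "'m topology" and A :: "('m, 'n::finite + 'n) chart set" and g J \<omega> :: "('m, 'n + 'n) tensor2" +
  fixes act :: "real^'n \<Rightarrow> 'm \<Rightarrow> 'm" and \<mu> :: "'m \<Rightarrow> real^'n"
  assumes act_closed: "p \<in> topspace X \<Longrightarrow> act t p \<in> topspace X"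
    and act_zero: "p \<in> topspace X \<Longrightarrow> act 0 p = p"
    and act_add: "p \<in> topspace X \<Longrightarrow> act (s + t) p = act s (act t p)"
    and act_lattice: "p \<in> topspace X \<Longrightarrow> t \<in> torus_lattice \<Longrightarrow> act t p = p"
    and act_smooth: "c \<in> A \<Longrightarrow> c' \<in> A \<Longrightarrow>
          open {(t, y). y \<in> chart_image c \<and> act t (chart_inv c y) \<in> chart_dom c'} \<and>
          smooth_on {(t, y). y \<in> chart_image c \<and> act t (chart_inv c y) \<in> chart_dom c'}
            (\<lambda>(t, y). in_charts c c' (act t) y)"
    and act_metric: "c \<in> A \<Longrightarrow> c' \<in> A \<Longrightarrow> p \<in> chart_dom c \<Longrightarrow> act t p \<in> chart_dom c' \<Longrightarrow>
          g c p = transpose (jac c c' (act t) p) ** g c' (act t p) ** jac c c' (act t) p"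
    and act_complex: "c \<in> A \<Longrightarrow> c' \<in> A \<Longrightarrow> p \<in> chart_dom c \<Longrightarrow> act t p \<in> chart_dom c' \<Longrightarrow>
          jac c c' (act t) p ** J c p = J c' (act t p) ** jac c c' (act t) p"
    and act_form: "c \<in> A \<Longrightarrow> c' \<in> A \<Longrightarrow> p \<in> chart_dom c \<Longrightarrow> act t p \<in> chart_dom c' \<Longrightarrow>
          \<omega> c p = transpose (jac c c' (act t) p) ** \<omega> c' (act t p) ** jac c c' (act t) p"
    and moment_smooth: "c \<in> A \<Longrightarrow> smooth_on (chart_image c) (\<lambda>y. \<mu> (chart_inv c y))"
    and moment_invariant: "p \<in> topspace X \<Longrightarrow> \<mu> (act t p) = \<mu> p"
    \<comment> \<open>\<open>d\<mu>\<^sub>i(v) = \<omega>(v, X\<^sub>i)\<close>, the sign for which \<open>\<omega> = \<Sum> dx\<^sub>i \<and> d\<phi>\<^sub>i\<close> and \<open>X\<^sub>i = \<partial>/\<partial>\<phi>\<^sub>i\<close> give \<open>\<mu>\<^sub>i = x\<^sub>i\<close>.\<close>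
    and moment_hamiltonian: "c \<in> A \<Longrightarrow> p \<in> chart_dom c \<Longrightarrow>
          partial k (\<lambda>y. \<mu> (chart_inv c y) $ i) (chart_map c p) = (\<omega> c p *v generator act c i p) $ k"

definition free_locus :: "'m topology \<Rightarrow> (real^'n \<Rightarrow> 'm \<Rightarrow> 'm) \<Rightarrow> 'm set" where
  "free_locus X act = {p \<in> topspace X. \<forall>t. act t p = p \<longrightarrow> t \<in> torus_lattice}"

text \<open>The coordinates of a symplectic chart are \<open>x\<^sub>i\<close> (index \<^term>\<open>Inl i\<close>) and \<open>\<phi>\<^sub>i\<close> (index
  \<^term>\<open>Inr i\<close>), the latter a local real-valued lift of the angular coordinates on the torus.\<close>

definition coord_x :: "('m, 'n::finite + 'n) chart \<Rightarrow> 'm \<Rightarrow> real^'n" where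
  "coord_x c p = (\<chi> i. chart_map c p $ Inl i)"

definition coord_phi :: "('m, 'n::finite + 'n) chart \<Rightarrow> 'm \<Rightarrow> real^'n" where
  "coord_phi c p = (\<chi> i. chart_map c p $ Inr i)"

definition symplectic_coordinates ::
  "'m topology \<Rightarrow> ('m, 'n::finite + 'n) chart set \<Rightarrow> ('m, 'n + 'n) tensor2 \<Rightarrow> ('m, 'n + 'n) tensor2 \<Rightarrow>
   (real^'n \<Rightarrow> 'm \<Rightarrow> 'm) \<Rightarrow> ('m \<Rightarrow> real^'n) \<Rightarrow>
   ('m, 'n + 'n) chart \<Rightarrow> (real^'n \<Rightarrow> real^'n^'n) \<Rightarrow> (real^'n \<Rightarrow> real) \<Rightarrow> bool" where
  "symplectic_coordinates X A g \<omega> act \<mu> c h \<Phi> \<longleftrightarrow>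
     c \<in> A \<and> chart_dom c \<subseteq> free_locus X act \<and>
     (\<forall>p\<in>chart_dom c. coord_x c p = \<mu> p) \<and>
     (\<forall>p\<in>chart_dom c. \<forall>t. act t p \<in> chart_dom c \<longrightarrow>
        coord_phi c (act t p) - (coord_phi c p + t) \<in> torus_lattice) \<and>
     (\<forall>p\<in>chart_dom c. \<omega> c p = block 0 (mat 1) (- mat 1) 0) \<and>
     (\<forall>p\<in>chart_dom c. g c p = block (matrix_inv (h (coord_x c p))) 0 0 (h (coord_x c p))) \<and>
     (\<forall>x \<in> coord_x c ` chart_dom c. symmetric_mat (h x) \<and> pos_definite (h x)) \<and>
     smooth_on (coord_x c ` chart_dom c) \<Phi> \<and>
     (\<forall>x \<in> coord_x c ` chart_dom c. \<forall>i j.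
        matrix_inv (h x) $ i $ j = partial i (partial j \<Phi>) x)"

end

theory Submission
  imports Defs
begin

text \<open>In symplectic coordinates the metric is \<open>diag(P, h)\<close> with \<open>P = h\<^sup>-\<^sup>1 = Hess \<Phi>\<close> depending on
  \<open>x\<close> only, and \<open>\<partial>\<^sub>a P\<^sub>b\<^sub>c\<close> is totally symmetric. Its Christoffel symbols are, up to the factors
  \<open>\<plusminus> 1/2\<close>, the contractions \<open>T\<^sup>a\<^sub>b\<^sub>c = h\<^sub>a\<^sub>d \<partial>\<^sub>d P\<^sub>b\<^sub>c\<close> and \<open>U\<^sub>a\<^sub>b\<^sub>c = - h\<^sub>a\<^sub>d \<partial>\<^sub>d h\<^sub>b\<^sub>c\<close>. In the scalar curvature
  all terms quadratic in \<open>\<partial>P\<close> are multiples of the single contraction \<open>Q = U\<^sub>a\<^sub>b\<^sub>c \<partial>\<^sub>a P\<^sub>b\<^sub>c\<close> and cancel, leaving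
  the divergence \<open>\<partial>\<^sub>a W\<^sub>a\<close> of \<open>W\<^sub>a = h\<^sub>b\<^sub>c T\<^sup>a\<^sub>b\<^sub>c = P\<^sub>b\<^sub>c U\<^sub>a\<^sub>b\<^sub>c\<close>. By Jacobi's formula
  \<open>det h W\<^sub>a = - h\<^sub>a\<^sub>d \<partial>\<^sub>d det h\<close>; differentiating this and using \<open>\<partial>\<^sub>a h\<^sub>a\<^sub>d = - W\<^sub>d\<close> gives the
  formula.\<close>

section \<open>Partial derivatives\<close>

lemma partial_eqI: "(f has_derivative f') (at x) \<Longrightarrow> partial i f x = f' (axis i 1)"
  unfolding partial_def using frechet_derivative_at by metis

lemma has_derivative_frechet:
  "f differentiable at x \<Longrightarrow> (f has_derivative frechet_derivative f (at x)) (at x)"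
  by (simp add: frechet_derivative_works)

lemma frechet_derivative_cong_on:
  assumes "open S" "x \<in> S" "\<And>y. y \<in> S \<Longrightarrow> f y = g y"
  shows "frechet_derivative f (at x) = frechet_derivative g (at x)"
proof -
  \<comment> \<open>\<open>frechet_derivative\<close> is a choice among the derivatives of a
    function at a point. Functions with the same derivatives thus get the same value, and this
    covers points of non-differentiability too.\<close>
  have "(f has_derivative D) (at x) \<longleftrightarrow> (g has_derivative D) (at x)" for D
    using has_derivative_transform_within_open[of f D x UNIV S g]
      has_derivative_transform_within_open[of g D x UNIV S f] assms by auto
  then show ?thesis
    by (simp add: frechet_derivative_def)
qed

lemma partial_cong_on:
  assumes "open S" "x \<in> S" "\<And>y. y \<in> S \<Longrightarrow> f y = g y"
  shows "partial i f x = partial i g x"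
  unfolding partial_def using frechet_derivative_cong_on[OF assms] by simp

lemma differentiable_cong_on:
  assumes "f differentiable at x" "open S" "x \<in> S" "\<And>y. y \<in> S \<Longrightarrow> f y = g y"
  shows "g differentiable at x"
  using assms has_derivative_transform_within_open unfolding differentiable_def by blast

lemma partial_const [simp]: "partial i (\<lambda>x. c) x = 0"
  by (rule partial_eqI[THEN trans]) (rule has_derivative_const, simp)

lemma partial_minus:
  "f differentiable at x \<Longrightarrow> partial i (\<lambda>x. - f x) x = - partial i f x"
  by (subst partial_eqI, rule has_derivative_minus[OF has_derivative_frechet])
     (auto simp: partial_def)

lemma partial_mult:
  "f differentiable at x \<Longrightarrow> g differentiable at x \<Longrightarrow>
    partial i (\<lambda>x. f x * g x) x = partial i f x * g x + f x * partial i g x"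
  by (subst partial_eqI, rule has_derivative_mult[OF has_derivative_frechet has_derivative_frechet])
     (auto simp: partial_def)

lemma partial_cmult:
  "f differentiable at x \<Longrightarrow> partial i (\<lambda>x. c * f x) x = c * partial i f x"
  by (simp add: partial_mult)

lemma partial_divide_const:
  "f differentiable at x \<Longrightarrow> partial i (\<lambda>x. f x / c) x = partial i f x / c"
  using partial_cmult[of f x i "inverse c"] by (simp add: divide_inverse mult.commute)

lemma partial_sum:
  "(\<And>k. k \<in> K \<Longrightarrow> f k differentiable at x) \<Longrightarrow>
    partial i (\<lambda>x. \<Sum>k\<in>K. f k x) x = (\<Sum>k\<in>K. partial i (f k) x)"
  by (subst partial_eqI, rule has_derivative_sum[OF has_derivative_frechet])
     (auto simp: partial_def)

lemma differentiable_prod: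
  fixes f :: "'i \<Rightarrow> 'a::real_normed_vector \<Rightarrow> real"
  shows "(\<And>k. k \<in> K \<Longrightarrow> f k differentiable at x) \<Longrightarrow> (\<lambda>x. \<Prod>k\<in>K. f k x) differentiable at x"
  using has_derivative_prod[of K f _ x UNIV] has_derivative_frechet
  unfolding differentiable_def by metis

section \<open>Mean values and the symmetry of second partial derivatives\<close>

lemma has_field_derivative_partial:
  assumes "f differentiable at (p + s *\<^sub>R axis i 1)"
  shows "((\<lambda>s. f (p + s *\<^sub>R axis i 1)) has_field_derivative partial i f (p + s *\<^sub>R axis i 1)) (at s)"
proof -
  have "((\<lambda>s. p + s *\<^sub>R axis i 1 :: real^'a) has_derivative (\<lambda>h. h *\<^sub>R axis i 1)) (at s)"
    by (auto intro!: derivative_eq_intros)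
  from has_derivative_compose[OF this has_derivative_frechet[OF assms]]
  have "((\<lambda>s. f (p + s *\<^sub>R axis i 1)) has_derivative
     (\<lambda>h. frechet_derivative f (at (p + s *\<^sub>R axis i 1)) (h *\<^sub>R axis i 1))) (at s)" .
  moreover have "frechet_derivative f (at (p + s *\<^sub>R axis i 1)) (h *\<^sub>R axis i 1) =
      partial i f (p + s *\<^sub>R axis i 1) * h" for h
    using linear_frechet_derivative[OF assms] by (simp add: partial_def linear_scale)
  ultimately show ?thesis
    by (simp add: has_field_derivative_def)
qed

text \<open>The mean value theorem is used twice: in direction \<open>i\<close> for the difference
  of \<open>f\<close> along two parallel edges, then in direction \<open>j\<close> for
  \<open>partial i f\<close>.\<close>

lemma second_difference_mean_value:
  fixes f :: "real^'k::finite \<Rightarrow> real"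
  assumes "t > 0" "2 * t < r"
    and f: "\<And>y. y \<in> ball x r \<Longrightarrow> f differentiable at y"
    and fi: "\<And>y. y \<in> ball x r \<Longrightarrow> partial i f differentiable at y"
  obtains y where "y \<in> ball x r"
    "f (x + t *\<^sub>R axis i 1 + t *\<^sub>R axis j 1) - f (x + t *\<^sub>R axis i 1) - f (x + t *\<^sub>R axis j 1) + f x =
      t * t * partial j (partial i f) y"
proof -
  let ?e = "\<lambda>i. axis i 1 :: real^'k"
  \<comment> \<open>The case \<open>i = j\<close> is included, so the displacement is bounded by the
    triangle inequality. This is where \<open>2 * t < r\<close> is used.\<close>
  have ball: "x + a *\<^sub>R ?e i + b *\<^sub>R ?e j \<in> ball x r" if "0 \<le> a" "a \<le> t" "0 \<le> b" "b \<le> t" for a b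
  proof -
    have "norm (a *\<^sub>R ?e i + b *\<^sub>R ?e j) \<le> a + b"
      using norm_triangle_ineq[of "a *\<^sub>R ?e i" "b *\<^sub>R ?e j"] that by simp
    moreover have "dist x (x + a *\<^sub>R ?e i + b *\<^sub>R ?e j) = norm (a *\<^sub>R ?e i + b *\<^sub>R ?e j)"
      by (metis add.assoc add_diff_cancel_left' dist_commute dist_norm)
    ultimately show ?thesis
      using that assms by simp
  qed
  define \<phi> where "\<phi> s = f (x + t *\<^sub>R ?e j + s *\<^sub>R ?e i) - f (x + s *\<^sub>R ?e i)" for s
  have \<phi>: "(\<phi> has_field_derivative
      partial i f (x + t *\<^sub>R ?e j + s *\<^sub>R ?e i) - partial i f (x + s *\<^sub>R ?e i)) (at s)"
    if "0 \<le> s" "s \<le> t" for s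
    unfolding \<phi>_def
    using ball[of s t] ball[of s 0] that assms(1)
    by (intro DERIV_diff has_field_derivative_partial f) (auto simp: algebra_simps)
  obtain \<xi> where \<xi>: "0 < \<xi>" "\<xi> < t" and 1: "\<phi> t - \<phi> 0 =
      (t - 0) * (partial i f (x + t *\<^sub>R ?e j + \<xi> *\<^sub>R ?e i) - partial i f (x + \<xi> *\<^sub>R ?e i))"
    using MVT2[OF \<open>t > 0\<close> \<phi>] by auto
  have \<psi>: "((\<lambda>s. partial i f ((x + \<xi> *\<^sub>R ?e i) + s *\<^sub>R ?e j)) has_field_derivative
      partial j (partial i f) ((x + \<xi> *\<^sub>R ?e i) + s *\<^sub>R ?e j)) (at s)"
    if "0 \<le> s" "s \<le> t" for s
    using ball[of \<xi> s] that \<xi> by (intro has_field_derivative_partial fi) auto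
  obtain \<eta> where \<eta>: "0 < \<eta>" "\<eta> < t" and 2:
    "partial i f ((x + \<xi> *\<^sub>R ?e i) + t *\<^sub>R ?e j) - partial i f ((x + \<xi> *\<^sub>R ?e i) + 0 *\<^sub>R ?e j) =
     (t - 0) * partial j (partial i f) ((x + \<xi> *\<^sub>R ?e i) + \<eta> *\<^sub>R ?e j)"
    using MVT2[OF \<open>t > 0\<close> \<psi>] by auto
  show thesis
  proof (rule that)
    show "x + \<xi> *\<^sub>R ?e i + \<eta> *\<^sub>R ?e j \<in> ball x r"
      using ball \<xi> \<eta> by simp
    have c: "x + t *\<^sub>R ?e j + \<xi> *\<^sub>R ?e i = x + \<xi> *\<^sub>R ?e i + t *\<^sub>R ?e j"
      by (simp add: algebra_simps)
    show "f (x + t *\<^sub>R ?e i + t *\<^sub>R ?e j) - f (x + t *\<^sub>R ?e i) - f (x + t *\<^sub>R ?e j) + f x =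
      t * t * partial j (partial i f) (x + \<xi> *\<^sub>R ?e i + \<eta> *\<^sub>R ?e j)"
      using 1 2 unfolding \<phi>_def c by (simp add: algebra_simps)
  qed
qed

text \<open>The second difference of \<open>f\<close> is symmetric in \<open>i\<close> and
  \<open>j\<close>, so the two mixed partials share a value at points arbitrarily close to
  \<open>x\<close>. By continuity they cannot differ at \<open>x\<close>.\<close>

lemma partial_commute:
  fixes f :: "real^'k::finite \<Rightarrow> real"
  assumes S: "open S" "x \<in> S"
    and f: "\<And>y. y \<in> S \<Longrightarrow> f differentiable at y"
    and fi: "\<And>k y. y \<in> S \<Longrightarrow> partial k f differentiable at y"
    and cont: "\<And>k l. continuous_on S (partial k (partial l f))"
  shows "partial i (partial j f) x = partial j (partial i f) x"
proof (rule ccontr)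
  assume ne: "partial i (partial j f) x \<noteq> partial j (partial i f) x"
  \<comment> \<open>Half the gap: if both mixed partials stay within \<open>e\<close> of their
    values at \<open>x\<close>, a common value would force the gap below
    \<open>2 * e\<close>.\<close>
  define e where "e = dist (partial i (partial j f) x) (partial j (partial i f) x) / 2"
  have "e > 0" using ne by (simp add: e_def)
  have "\<exists>d>0. \<forall>y. dist y x < d \<longrightarrow> y \<in> S \<and> dist (partial k (partial l f) y) (partial k (partial l f) x) < e" for k l
  proof -
    have "isCont (partial k (partial l f)) x"
      using cont S continuous_on_eq_continuous_at by blast
    then obtain d where d: "d > 0" "\<And>y. dist y x < d \<Longrightarrow> dist (partial k (partial l f) y) (partial k (partial l f) x) < e"
      using \<open>e > 0\<close> unfolding continuous_at_eps_delta dist_real_def dist_norm by blast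
    moreover obtain d' where "d' > 0" "\<And>y. dist y x < d' \<Longrightarrow> y \<in> S"
      using S unfolding open_dist by blast
    ultimately show ?thesis
      by (intro exI[of _ "min d d'"]) auto
  qed
  then obtain d d' where d: "d > 0" "d' > 0"
    "\<And>y. dist y x < d \<Longrightarrow> y \<in> S \<and> dist (partial i (partial j f) y) (partial i (partial j f) x) < e"
    "\<And>y. dist y x < d' \<Longrightarrow> y \<in> S \<and> dist (partial j (partial i f) y) (partial j (partial i f) x) < e"
    by meson
  define r where "r = min d d'"
  have r: "r > 0" "\<And>y. y \<in> ball x r \<Longrightarrow> y \<in> S"
    "\<And>y. y \<in> ball x r \<Longrightarrow> dist (partial i (partial j f) y) (partial i (partial j f) x) < e"
    "\<And>y. y \<in> ball x r \<Longrightarrow> dist (partial j (partial i f) y) (partial j (partial i f) x) < e"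
    using d by (auto simp: r_def dist_commute)
  define t where "t = r / 4"
  have t: "t > 0" "2 * t < r" using r(1) by (auto simp: t_def)
  obtain y where y: "y \<in> ball x r"
    "f (x + t *\<^sub>R axis i 1 + t *\<^sub>R axis j 1) - f (x + t *\<^sub>R axis i 1) - f (x + t *\<^sub>R axis j 1) + f x =
      t * t * partial j (partial i f) y"
    using second_difference_mean_value[OF t, of x f i j] f fi r(2) by blast
  obtain z where z: "z \<in> ball x r"
    "f (x + t *\<^sub>R axis j 1 + t *\<^sub>R axis i 1) - f (x + t *\<^sub>R axis j 1) - f (x + t *\<^sub>R axis i 1) + f x =
      t * t * partial i (partial j f) z"
    using second_difference_mean_value[OF t, of x f j i] f fi r(2) by blast
  have "f (x + t *\<^sub>R axis j 1 + t *\<^sub>R axis i 1) = f (x + t *\<^sub>R axis i 1 + t *\<^sub>R axis j 1)"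
    by (simp add: algebra_simps)
  then have "t * t * partial j (partial i f) y = t * t * partial i (partial j f) z"
    using y(2) z(2) by linarith
  then have "partial j (partial i f) y = partial i (partial j f) z"
    using t by simp
  then show False
    using dist_triangle_half_r[OF r(3)[OF z(1), unfolded e_def], of "partial j (partial i f) x"]
      r(4)[OF y(1)] by (simp add: e_def)
qed

section \<open>Determinants and inverses of matrix functions\<close>

lemma differentiable_det:
  fixes A :: "'a::real_normed_vector \<Rightarrow> real^'n::finite^'n"
  assumes "\<And>a b. (\<lambda>x. A x $ a $ b) differentiable at x"
  shows "(\<lambda>x. det (A x)) differentiable at x"
  unfolding det_def
  by (intro differentiable_sum ballI differentiable_mult differentiable_const differentiable_prod assms)
     simp

text \<open>Jacobi's formula, with \<open>det (A x)\<close> times \<open>B\<close> in place of the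
  adjugate. The product rule replaces one row at a time by its derivative, and \<open>B\<close>
  expands the new row in the old ones.\<close>

lemma partial_det:
  fixes A :: "real^'k::finite \<Rightarrow> real^'n::finite^'n"
  assumes diff: "\<And>a b. (\<lambda>x. A x $ a $ b) differentiable at x"
    and inv: "B ** A x = mat 1"
  shows "partial i (\<lambda>x. det (A x)) x =
    det (A x) * (\<Sum>a\<in>UNIV. \<Sum>b\<in>UNIV. partial i (\<lambda>x. A x $ a $ b) x * B $ b $ a)"
proof -
  define A' :: "real^'n^'n" where "A' = (\<chi> a b. partial i (\<lambda>x. A x $ a $ b) x)"
  let ?S = "{p. p permutes (UNIV :: 'n set)}"
  have pr: "partial i (\<lambda>x. \<Prod>a\<in>UNIV. A x $ a $ p a) x =
      (\<Sum>k\<in>UNIV. A' $ k $ p k * (\<Prod>a\<in>UNIV - {k}. A x $ a $ p a))" for p :: "'n \<Rightarrow> 'n"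
    by (subst partial_eqI, rule has_derivative_prod[OF has_derivative_frechet[OF diff]])
       (simp add: A'_def partial_def)
  \<comment> \<open>Each term of the product rule is a Leibniz product of the matrix with row
    \<open>k\<close> replaced.\<close>
  have repl: "(\<Prod>a\<in>UNIV. (\<chi> r. if r = k then A' $ k else A x $ r) $ a $ p a) =
      A' $ k $ p k * (\<Prod>a\<in>UNIV - {k}. A x $ a $ p a)" for k :: 'n and p
    by (subst prod.remove[of UNIV k]) auto
  \<comment> \<open>Read row by row, this writes each row of \<open>A'\<close> as a combination of
    the rows of \<open>A x\<close> with coefficients from \<open>A' ** B\<close>. In the determinant
    only the diagonal coefficient survives.\<close>
  have A': "A' = (A' ** B) ** A x"
    by (simp add: matrix_mul_assoc[symmetric] inv)
  have "partial i (\<lambda>x. det (A x)) x =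
    (\<Sum>p\<in>?S. of_int (sign p) * (\<Sum>k\<in>UNIV. A' $ k $ p k * (\<Prod>a\<in>UNIV - {k}. A x $ a $ p a)))"
    unfolding det_def
    by (subst partial_sum)
       (simp_all add: partial_cmult diff pr differentiable_prod)
  also have "\<dots> = (\<Sum>p\<in>?S. \<Sum>k\<in>UNIV. of_int (sign p) *
      (\<Prod>a\<in>UNIV. (\<chi> r. if r = k then A' $ k else A x $ r) $ a $ p a))"
    unfolding repl by (simp add: sum_distrib_left)
  also have "\<dots> = (\<Sum>k\<in>UNIV. det (\<chi> r. if r = k then A' $ k else A x $ r))"
    unfolding det_def by (rule sum.swap)
  also have "\<dots> = (\<Sum>k\<in>UNIV. (A' ** B) $ k $ k * det (A x))"
  proof (rule sum.cong[OF refl])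
    fix k
    have "A' $ k = (\<Sum>j\<in>UNIV. (A' ** B) $ k $ j *s row j (A x))"
      by (subst A') (simp add: vec_eq_iff matrix_matrix_mult_def row_def)
    then have "(\<chi> r. if r = k then A' $ k else A x $ r) =
      (\<chi> r. if r = k then \<Sum>j\<in>UNIV. ((A' ** B) $ k) $ j *s row j (A x) else row r (A x))"
      by (auto simp add: vec_eq_iff row_def)
    then show "det (\<chi> r. if r = k then A' $ k else A x $ r) = (A' ** B) $ k $ k * det (A x)"
      using cramer_lemma_transpose[of k "(A' ** B) $ k" "A x"] by simp
  qed
  also have "\<dots> = det (A x) * (\<Sum>a\<in>UNIV. \<Sum>b\<in>UNIV. partial i (\<lambda>x. A x $ a $ b) x * B $ b $ a)"
    by (simp add: sum_distrib_left sum_distrib_right matrix_matrix_mult_def A'_def mult_ac)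
  finally show ?thesis .
qed

text \<open>Column \<open>b\<close> of \<open>B\<close> solves \<open>A *v v = axis b 1\<close>, so
  Cramer's rule applies. As a quotient of determinants the entry is visibly differentiable.\<close>

lemma inverse_entry_cramer:
  fixes A B :: "real^'n::finite^'n"
  assumes "A ** B = mat 1"
  shows "B $ a $ b = det (\<chi> i j. if j = a then (if i = b then 1 else 0) else A $ i $ j) / det A"
proof -
  have "det A \<noteq> 0"
    using assms by (metis det_I det_mul mult_zero_left zero_neq_one)
  moreover have "A *v column b B = axis b 1"
    by (metis assms matrix_vector_mul_assoc matrix_vector_mul_lid matrix_vector_mult_basis)
  ultimately have "column b B = (\<chi> k. det (\<chi> i j. if j = k then axis b 1 $ i else A $ i $ j) / det A)"
    using cramer[of A "column b B" "axis b 1"] by blast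
  then have "column b B $ a = det (\<chi> i j. if j = a then axis b 1 $ i else A $ i $ j) / det A"
    by simp
  moreover have "(\<chi> i j. if j = a then axis b 1 $ i else A $ i $ j) =
    (\<chi> i j. if j = a then (if i = b then 1 else 0) else A $ i $ j)"
    by (simp add: vec_eq_iff axis_def)
  ultimately show ?thesis
    by (simp add: column_def)
qed

lemma differentiable_inverse_entry:
  fixes A B :: "'a::real_normed_vector \<Rightarrow> real^'n::finite^'n"
  assumes "open S" "x \<in> S"
    and diff: "\<And>a b. (\<lambda>x. A x $ a $ b) differentiable at x"
    and inv: "\<And>y. y \<in> S \<Longrightarrow> A y ** B y = mat 1"
  shows "(\<lambda>x. B x $ a $ b) differentiable at x"
proof (rule differentiable_cong_on[OF _ assms(1,2)])
  have "det (A x) \<noteq> 0"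
    using inv[OF \<open>x \<in> S\<close>] by (metis det_I det_mul mult_zero_left zero_neq_one)
  moreover have "(\<lambda>x. (\<chi> i j. if j = a then (if i = b then 1 else 0) else A x $ i $ j) $ k $ l)
      differentiable at x" for k l
    using diff by (cases "l = a") simp_all
  ultimately show "(\<lambda>x. det (\<chi> i j. if j = a then (if i = b then 1 else 0) else A x $ i $ j) / det (A x))
      differentiable at x"
    using diff by (intro differentiable_divide differentiable_det)
qed (simp add: inverse_entry_cramer[OF inv])

section \<open>The tensors of a Hessian metric\<close>

text \<open>An index moved by \<open>B\<close> is moved back by \<open>A\<close>. Most contractions
  below reduce to this.\<close>

lemma inverse_contract:
  fixes A B :: "real^'n::finite^'n"
  assumes "A ** B = mat 1"
  shows "(\<Sum>a\<in>UNIV. A $ e $ a * (\<Sum>d\<in>UNIV. B $ a $ d * f d)) = f e"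
proof -
  have "A *v (B *v (\<chi> d. f d)) = (\<chi> d. f d)"
    by (simp add: matrix_vector_mul_assoc assms)
  then show ?thesis
    by (simp add: vec_eq_iff matrix_vector_mult_def)
qed

text \<open>Lets a row \<open>p\<close> of \<open>h\<close> or \<open>P\<close> act directly on one
  index of a tensor \<open>t\<close> that stands inside a contraction with \<open>u\<close>.\<close>

lemma sum_mult_swap:
  fixes p :: "'a \<Rightarrow> real"
  shows "(\<Sum>c\<in>C. p c * (\<Sum>a\<in>A. \<Sum>b\<in>B. u a b * t c a b)) = (\<Sum>a\<in>A. \<Sum>b\<in>B. u a b * (\<Sum>c\<in>C. p c * t c a b))"
proof -
  have "(\<Sum>c\<in>C. p c * (\<Sum>a\<in>A. \<Sum>b\<in>B. u a b * t c a b)) = (\<Sum>c\<in>C. \<Sum>a\<in>A. \<Sum>b\<in>B. u a b * (p c * t c a b))"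
    by (simp add: sum_distrib_left mult_ac)
  also have "\<dots> = (\<Sum>a\<in>A. \<Sum>c\<in>C. \<Sum>b\<in>B. u a b * (p c * t c a b))"
    by (rule sum.swap)
  also have "\<dots> = (\<Sum>a\<in>A. \<Sum>b\<in>B. \<Sum>c\<in>C. u a b * (p c * t c a b))"
    by (intro sum.cong refl sum.swap)
  finally show ?thesis
    by (simp add: sum_distrib_left)
qed

lemma sum_rotate:
  "(\<Sum>b\<in>B. \<Sum>c\<in>C. \<Sum>a\<in>A. f a b c) = (\<Sum>a\<in>A. \<Sum>b\<in>B. \<Sum>c\<in>C. f a b c)"
proof -
  have "(\<Sum>b\<in>B. \<Sum>c\<in>C. \<Sum>a\<in>A. f a b c) = (\<Sum>b\<in>B. \<Sum>a\<in>A. \<Sum>c\<in>C. f a b c)"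
    by (intro sum.cong refl sum.swap)
  then show ?thesis
    using sum.swap[of "\<lambda>b a. \<Sum>c\<in>C. f a b c" A B] by simp
qed

lemma sum_rotate_mult:
  fixes k :: "'b \<Rightarrow> 'c \<Rightarrow> real"
  shows "(\<Sum>b\<in>B. \<Sum>c\<in>C. k b c * (\<Sum>a\<in>A. t a b c)) = (\<Sum>a\<in>A. \<Sum>b\<in>B. \<Sum>c\<in>C. k b c * t a b c)"
  unfolding sum_distrib_left by (rule sum_rotate)

text \<open>\<open>P\<close> stands for the Hessian of the potential: \<open>P_sym\<close> and
  \<open>dP_swap\<close> together make its derivative totally symmetric. The differentiability of
  \<open>h\<close> is derived from that of \<open>P\<close>.\<close>

locale hessian_metric =
  fixes V :: "(real^'n::finite) set" and h P :: "real^'n \<Rightarrow> real^'n^'n"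
  assumes open_V: "open V"
    and h_sym: "x \<in> V \<Longrightarrow> h x $ b $ c = h x $ c $ b"
    and P_sym: "x \<in> V \<Longrightarrow> P x $ b $ c = P x $ c $ b"
    and hP: "x \<in> V \<Longrightarrow> h x ** P x = mat 1"
    and P_diff: "x \<in> V \<Longrightarrow> (\<lambda>x. P x $ b $ c) differentiable at x"
    and dP_diff: "x \<in> V \<Longrightarrow> partial a (\<lambda>x. P x $ b $ c) differentiable at x"
    and dP_swap: "x \<in> V \<Longrightarrow> partial a (\<lambda>x. P x $ b $ c) x = partial b (\<lambda>x. P x $ a $ c) x"
begin

definition dP :: "'n \<Rightarrow> 'n \<Rightarrow> 'n \<Rightarrow> real^'n \<Rightarrow> real" where
  "dP a b c = partial a (\<lambda>x. P x $ b $ c)"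

definition dh :: "'n \<Rightarrow> 'n \<Rightarrow> 'n \<Rightarrow> real^'n \<Rightarrow> real" where
  "dh a b c = partial a (\<lambda>x. h x $ b $ c)"

definition T :: "'n \<Rightarrow> 'n \<Rightarrow> 'n \<Rightarrow> real^'n \<Rightarrow> real" where
  "T a b c x = (\<Sum>d\<in>UNIV. h x $ a $ d * dP d b c x)"

text \<open>Since the derivative of an inverse is \<open>- h dP h\<close>, this is \<open>dP\<close>
  with all three indices moved by \<open>h\<close>; the minus sign absorbs the one in that
  derivative.\<close>

definition U :: "'n \<Rightarrow> 'n \<Rightarrow> 'n \<Rightarrow> real^'n \<Rightarrow> real" where
  "U a b c x = - (\<Sum>d\<in>UNIV. h x $ a $ d * dh d b c x)"

definition W :: "'n \<Rightarrow> real^'n \<Rightarrow> real" where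
  "W a x = (\<Sum>b\<in>UNIV. \<Sum>c\<in>UNIV. h x $ b $ c * T a b c x)"

section \<open>Symmetry and differentiability of the tensors\<close>

lemma Ph: "x \<in> V \<Longrightarrow> P x ** h x = mat 1"
  using hP matrix_left_right_inverse by blast

lemma dP_sym: "x \<in> V \<Longrightarrow> dP a b c x = dP b a c x" "x \<in> V \<Longrightarrow> dP a b c x = dP a c b x"
  unfolding dP_def using dP_swap apply blast
  by (rule partial_cong_on[OF open_V]) (auto intro: P_sym)

lemma dh_sym: "x \<in> V \<Longrightarrow> dh a b c x = dh a c b x"
  unfolding dh_def by (rule partial_cong_on[OF open_V]) (auto intro: h_sym)

lemma h_diff: "x \<in> V \<Longrightarrow> (\<lambda>x. h x $ b $ c) differentiable at x"
  by (rule differentiable_inverse_entry[OF open_V _ P_diff Ph])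

lemma dP_differentiable: "x \<in> V \<Longrightarrow> dP a b c differentiable at x"
  unfolding dP_def by (rule dP_diff)

text \<open>Product rule applied to the constant matrix \<open>P x ** h x\<close>.\<close>

lemma P_dh:
  assumes "x \<in> V"
  shows "(\<Sum>d\<in>UNIV. P x $ c $ d * dh a d b x) = - (\<Sum>d\<in>UNIV. dP a c d x * h x $ d $ b)"
proof -
  have "partial a (\<lambda>x. \<Sum>d\<in>UNIV. P x $ c $ d * h x $ d $ b) x = partial a (\<lambda>x. mat 1 $ c $ b) x"
  proof (rule partial_cong_on[OF open_V assms])
    fix y assume "y \<in> V"
    then have "(P y ** h y) $ c $ b = mat 1 $ c $ b" by (simp add: Ph)
    then show "(\<Sum>d\<in>UNIV. P y $ c $ d * h y $ d $ b) = mat 1 $ c $ b"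
      by (simp add: matrix_matrix_mult_def)
  qed
  then show ?thesis
    using assms by (simp add: partial_sum partial_mult P_diff h_diff dP_def dh_def sum.distrib add_eq_0_iff)
qed

text \<open>\<open>P_dh\<close> multiplied by \<open>h\<close>. The right-hand side contains no
  derivative of \<open>h\<close>, hence is differentiable; \<open>dh_diff\<close> rests on
  this.\<close>

lemma dh_eq:
  assumes "x \<in> V"
  shows "dh a b c x = - (\<Sum>i\<in>UNIV. h x $ b $ i * (\<Sum>j\<in>UNIV. dP a i j x * h x $ j $ c))"
  using inverse_contract[OF hP[OF assms], of b "\<lambda>d. dh a d c x"]
  by (simp add: P_dh[OF assms] sum_negf)

lemma dh_diff: "x \<in> V \<Longrightarrow> dh a b c differentiable at x"
  by (rule differentiable_cong_on[OF _ open_V _ dh_eq[symmetric]])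
     (auto intro!: differentiable_minus differentiable_sum differentiable_mult h_diff dP_differentiable)

lemma T_diff: "x \<in> V \<Longrightarrow> T a b c differentiable at x"
  unfolding T_def by (auto intro!: differentiable_sum differentiable_mult h_diff dP_differentiable)

lemma U_diff: "x \<in> V \<Longrightarrow> U a b c differentiable at x"
  unfolding U_def by (auto intro!: differentiable_minus differentiable_sum differentiable_mult h_diff dh_diff)

lemma W_diff: "x \<in> V \<Longrightarrow> W a differentiable at x"
  unfolding W_def by (auto intro!: differentiable_sum differentiable_mult h_diff T_diff)

lemma T_sym: "x \<in> V \<Longrightarrow> T a b c x = T a c b x"
  unfolding T_def by (simp add: dP_sym(2)[of x _ b c])

lemma P_T: "x \<in> V \<Longrightarrow> (\<Sum>a\<in>UNIV. P x $ e $ a * T a b c x) = dP e b c x"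
  unfolding T_def by (rule inverse_contract[OF Ph])

lemma P_U: "x \<in> V \<Longrightarrow> (\<Sum>a\<in>UNIV. P x $ e $ a * U a b c x) = - dh e b c x"
  unfolding U_def by (simp add: sum_negf inverse_contract[OF Ph])

text \<open>Total symmetry of \<open>dP\<close> makes the index contracted with \<open>h\<close> in
  \<open>P_dh\<close> the differentiation index, as in \<open>T\<close>. This contraction yields the
  mixed Christoffel symbols.\<close>

lemma P_dh_T:
  assumes x: "x \<in> V"
  shows "(\<Sum>d\<in>UNIV. P x $ c $ d * dh a d b x) = - T b a c x"
proof -
  have "dP a c d x = dP d a c x" for d
    using dP_sym[OF x] by metis
  then show ?thesis
    by (simp add: P_dh[OF x] T_def h_sym[OF x, of b] mult.commute)
qed

text \<open>Inserting \<open>dh_eq\<close> into \<open>U\<close>, the two factors \<open>h\<close>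
  around \<open>dP\<close> move the last two indices, while the one already present turns
  \<open>dP\<close> into \<open>T\<close>.\<close>

lemma U_eq_T:
  assumes "x \<in> V"
  shows "U a b c x = (\<Sum>i\<in>UNIV. h x $ b $ i * (\<Sum>j\<in>UNIV. h x $ c $ j * T a i j x))"
proof -
  have "(\<Sum>i\<in>UNIV. h x $ b $ i * (\<Sum>j\<in>UNIV. h x $ c $ j * T a i j x)) =
    (\<Sum>i\<in>UNIV. \<Sum>j\<in>UNIV. (h x $ b $ i * h x $ c $ j) * (\<Sum>d\<in>UNIV. h x $ a $ d * dP d i j x))"
    by (simp add: T_def sum_distrib_left mult_ac)
  also have "\<dots> = (\<Sum>d\<in>UNIV. h x $ a $ d * (\<Sum>i\<in>UNIV. \<Sum>j\<in>UNIV. (h x $ b $ i * h x $ c $ j) * dP d i j x))"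
    by (rule sum_mult_swap[symmetric])
  also have "\<dots> = (\<Sum>d\<in>UNIV. h x $ a $ d * - dh d b c x)"
    by (simp add: dh_eq[OF assms] sum_distrib_left mult_ac h_sym[OF assms, of _ c])
  finally show ?thesis
    by (simp add: U_def sum_negf)
qed

lemma U_sym:
  assumes "x \<in> V"
  shows "U a b c x = U a c b x" "U a b c x = U b a c x"
proof -
  show "U a b c x = U a c b x"
    by (simp add: U_def dh_sym[OF assms, of _ b c])
  \<comment> \<open>The sums are ordered so that swapping the outer two exchanges the roles of
    \<open>a\<close> and \<open>b\<close>.\<close>
  have U: "U a b c x = (\<Sum>i\<in>UNIV. \<Sum>d\<in>UNIV. \<Sum>j\<in>UNIV. h x $ a $ d * h x $ b $ i * h x $ c $ j * dP d i j x)" for a b c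
  proof -
    have "U a b c x = (\<Sum>i\<in>UNIV. \<Sum>j\<in>UNIV. \<Sum>d\<in>UNIV. h x $ a $ d * h x $ b $ i * h x $ c $ j * dP d i j x)"
      by (simp add: U_eq_T[OF assms] T_def sum_distrib_left mult_ac)
    also have "\<dots> = (\<Sum>i\<in>UNIV. \<Sum>d\<in>UNIV. \<Sum>j\<in>UNIV. h x $ a $ d * h x $ b $ i * h x $ c $ j * dP d i j x)"
      by (intro sum.cong refl sum.swap)
    finally show ?thesis .
  qed
  show "U a b c x = U b a c x"
    unfolding U by (subst sum.swap) (simp add: dP_sym(1)[OF assms] mult_ac)
qed

text \<open>By \<open>U_eq_T\<close> the tensor \<open>U\<close> carries two factors
  \<open>h\<close> in front of \<open>T\<close>, and contraction with \<open>P\<close> cancels one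
  of them.\<close>

lemma W_eq_U:
  assumes "x \<in> V"
  shows "W a x = (\<Sum>b\<in>UNIV. \<Sum>c\<in>UNIV. P x $ b $ c * U a b c x)"
proof -
  have "(\<Sum>b\<in>UNIV. \<Sum>c\<in>UNIV. P x $ b $ c * U a b c x) =
      (\<Sum>c\<in>UNIV. \<Sum>b\<in>UNIV. P x $ c $ b * U a b c x)"
    by (subst sum.swap) (simp add: P_sym[OF assms])
  also have "\<dots> = (\<Sum>c\<in>UNIV. \<Sum>j\<in>UNIV. h x $ c $ j * T a c j x)"
    by (simp add: U_eq_T[OF assms] inverse_contract[OF Ph[OF assms]])
  finally show ?thesis
    by (simp add: W_def)
qed

section \<open>Quadratic contractions, all equal to \<open>Q\<close> up to sign\<close>

definition Q :: "real^'n \<Rightarrow> real" where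
  "Q x = (\<Sum>a\<in>UNIV. \<Sum>b\<in>UNIV. \<Sum>c\<in>UNIV. U a b c x * dP a b c x)"

text \<open>The second \<open>T\<close> is split as \<open>h\<close> times \<open>dP\<close>. Its
  \<open>h\<close> and the outer \<open>h\<close> move two indices of the first \<open>T\<close>,
  which thereby becomes \<open>U\<close>.\<close>

lemma T_T_trace:
  assumes x: "x \<in> V"
  shows "(\<Sum>b\<in>UNIV. \<Sum>c\<in>UNIV. h x $ b $ c * (\<Sum>a\<in>UNIV. \<Sum>d\<in>UNIV. T a b d x * T d a c x)) = Q x"
proof -
  have "(\<Sum>b\<in>UNIV. \<Sum>c\<in>UNIV. h x $ b $ c * (\<Sum>a\<in>UNIV. \<Sum>d\<in>UNIV. T a b d x * T d a c x)) =
    (\<Sum>c\<in>UNIV. \<Sum>b\<in>UNIV. h x $ c $ b * (\<Sum>a\<in>UNIV. \<Sum>d\<in>UNIV. T d a c x * T a b d x))"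
    by (subst sum.swap) (simp add: h_sym[OF x] mult.commute)
  also have "\<dots> = (\<Sum>c\<in>UNIV. \<Sum>a\<in>UNIV. \<Sum>d\<in>UNIV. T d a c x * (\<Sum>b\<in>UNIV. h x $ c $ b * T a b d x))"
    unfolding sum_mult_swap ..
  also have "\<dots> = (\<Sum>c\<in>UNIV. \<Sum>a\<in>UNIV. \<Sum>e\<in>UNIV. dP e a c x * U a c e x)"
  proof (rule sum.cong[OF refl], rule sum.cong[OF refl])
    fix c a
    have "(\<Sum>d\<in>UNIV. T d a c x * (\<Sum>b\<in>UNIV. h x $ c $ b * T a b d x)) =
      (\<Sum>d\<in>UNIV. \<Sum>e\<in>UNIV. dP e a c x * (h x $ e $ d * (\<Sum>b\<in>UNIV. h x $ c $ b * T a b d x)))"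
      unfolding T_def[of _ a c] by (simp add: sum_distrib_right mult_ac h_sym[OF x])
    also have "\<dots> = (\<Sum>e\<in>UNIV. dP e a c x * (\<Sum>d\<in>UNIV. h x $ e $ d * (\<Sum>b\<in>UNIV. h x $ c $ b * T a b d x)))"
      by (subst sum.swap) (simp add: sum_distrib_left)
    also have "\<dots> = (\<Sum>e\<in>UNIV. dP e a c x * U a e c x)"
      by (simp add: U_eq_T[OF x, of a] T_sym[OF x, of a])
    finally show "(\<Sum>d\<in>UNIV. T d a c x * (\<Sum>b\<in>UNIV. h x $ c $ b * T a b d x)) =
        (\<Sum>e\<in>UNIV. dP e a c x * U a c e x)"
      by (simp add: U_sym(1)[OF x, of a c])
  qed
  also have "\<dots> = Q x"
    unfolding Q_def
    by (intro sum.cong refl, subst dP_sym(2)[OF x], subst dP_sym(1)[OF x], subst U_sym(2)[OF x], subst dP_sym(2)[OF x]) simp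
  finally show ?thesis .
qed

text \<open>The factor \<open>P\<close> turns \<open>T\<close> back into \<open>dP\<close>.\<close>

lemma U_T_trace:
  assumes x: "x \<in> V"
  shows "(\<Sum>b\<in>UNIV. \<Sum>c\<in>UNIV. P x $ b $ c * (\<Sum>a\<in>UNIV. \<Sum>d\<in>UNIV. U a b d x * T c a d x)) = Q x"
proof -
  have "(\<Sum>b\<in>UNIV. \<Sum>c\<in>UNIV. P x $ b $ c * (\<Sum>a\<in>UNIV. \<Sum>d\<in>UNIV. U a b d x * T c a d x)) =
    (\<Sum>b\<in>UNIV. \<Sum>a\<in>UNIV. \<Sum>d\<in>UNIV. U a b d x * dP b a d x)"
    unfolding sum_mult_swap P_T[OF x] ..
  also have "\<dots> = Q x"
    unfolding Q_def by (simp add: U_sym(2)[OF x] dP_sym(1)[OF x])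
  finally show ?thesis .
qed

text \<open>The symmetries of \<open>T\<close> and \<open>U\<close>, with \<open>b\<close> and
  \<open>c\<close> exchanged, bring this to \<open>U_T_trace\<close>.\<close>

lemma T_U_trace:
  assumes x: "x \<in> V"
  shows "(\<Sum>b\<in>UNIV. \<Sum>c\<in>UNIV. P x $ b $ c * (\<Sum>a\<in>UNIV. \<Sum>d\<in>UNIV. T b d a x * U d a c x)) = Q x"
proof -
  have eq: "T b d a x * U d a c x = U a c d x * T b a d x" for a b c d
    using T_sym[OF x, of b d a] U_sym(1)[OF x, of a c d] U_sym(2)[OF x, of a d c] by simp
  have "(\<Sum>b\<in>UNIV. \<Sum>c\<in>UNIV. P x $ b $ c * (\<Sum>a\<in>UNIV. \<Sum>d\<in>UNIV. T b d a x * U d a c x)) =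
    (\<Sum>b\<in>UNIV. \<Sum>c\<in>UNIV. P x $ b $ c * (\<Sum>a\<in>UNIV. \<Sum>d\<in>UNIV. U a b d x * T c a d x))"
    by (subst sum.swap) (simp add: eq P_sym[OF x])
  then show ?thesis
    using U_T_trace[OF x] by simp
qed

text \<open>Writing \<open>dh\<close> as minus \<open>P\<close> times \<open>U\<close> frees a
  factor \<open>P\<close>, which turns \<open>T\<close> into \<open>dP\<close>.\<close>

lemma dh_T_trace:
  assumes x: "x \<in> V"
  shows "(\<Sum>a\<in>UNIV. \<Sum>b\<in>UNIV. \<Sum>c\<in>UNIV. dh a b c x * T a b c x) = - Q x"
proof -
  have dh_U: "dh a b c x = - (\<Sum>d\<in>UNIV. P x $ a $ d * U d b c x)" for a b c
    by (simp add: P_U[OF x])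
  have "(\<Sum>a\<in>UNIV. \<Sum>b\<in>UNIV. \<Sum>c\<in>UNIV. dh a b c x * T a b c x) =
    - (\<Sum>a\<in>UNIV. \<Sum>b\<in>UNIV. \<Sum>c\<in>UNIV. \<Sum>d\<in>UNIV. P x $ d $ a * U d b c x * T a b c x)"
    by (simp add: dh_U sum_distrib_right sum_negf P_sym[OF x])
  also have "\<dots> = - (\<Sum>d\<in>UNIV. \<Sum>a\<in>UNIV. P x $ d $ a * (\<Sum>b\<in>UNIV. \<Sum>c\<in>UNIV. U d b c x * T a b c x))"
  proof -
    have "(\<Sum>a\<in>UNIV. \<Sum>b\<in>UNIV. \<Sum>c\<in>UNIV. \<Sum>d\<in>UNIV. P x $ d $ a * U d b c x * T a b c x) =
      (\<Sum>a\<in>UNIV. \<Sum>d\<in>UNIV. \<Sum>b\<in>UNIV. \<Sum>c\<in>UNIV. P x $ d $ a * U d b c x * T a b c x)"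
      by (intro sum.cong refl sum_rotate)
    then show ?thesis
      by (subst (2) sum.swap) (simp add: sum_distrib_left mult.assoc)
  qed
  also have "\<dots> = - Q x"
    unfolding sum_mult_swap P_T[OF x] Q_def ..
  finally show ?thesis .
qed

section \<open>The divergence of \<open>W\<close> from each of its two expressions, and the scalar
  curvature\<close>

lemma partial_W_T:
  "x \<in> V \<Longrightarrow> partial a (W a) x =
    (\<Sum>b\<in>UNIV. \<Sum>c\<in>UNIV. dh a b c x * T a b c x) + (\<Sum>b\<in>UNIV. \<Sum>c\<in>UNIV. h x $ b $ c * partial a (T a b c) x)"
  unfolding W_def
  by (simp add: partial_sum partial_mult h_diff T_diff differentiable_sum dh_def sum.distrib)

lemma partial_W_U:
  assumes x: "x \<in> V"
  shows "partial a (W a) x =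
    (\<Sum>b\<in>UNIV. \<Sum>c\<in>UNIV. U a b c x * dP a b c x) + (\<Sum>b\<in>UNIV. \<Sum>c\<in>UNIV. P x $ b $ c * partial a (U a b c) x)"
proof -
  have "partial a (W a) x = partial a (\<lambda>x. \<Sum>b\<in>UNIV. \<Sum>c\<in>UNIV. P x $ b $ c * U a b c x) x"
    by (rule partial_cong_on[OF open_V x W_eq_U])
  then show ?thesis
    using x by (simp add: partial_sum partial_mult P_diff U_diff differentiable_sum dP_def sum.distrib mult.commute)
qed

text \<open>The Ricci components in the \<open>x\<close> and \<open>\<phi>\<close> directions. The terms containing the traces
  \<open>T\<^sup>a\<^sub>a\<^sub>b\<close> are absent because the metric \<open>diag(P, h)\<close> has determinant 1.\<close>

definition ric_x :: "'n \<Rightarrow> 'n \<Rightarrow> real^'n \<Rightarrow> real" where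
  "ric_x b c x = (1/2) * (\<Sum>a\<in>UNIV. partial a (T a b c) x) - (1/2) * (\<Sum>a\<in>UNIV. \<Sum>d\<in>UNIV. T a b d x * T d a c x)"

definition ric_phi :: "'n \<Rightarrow> 'n \<Rightarrow> real^'n \<Rightarrow> real" where
  "ric_phi b c x = (1/2) * (\<Sum>a\<in>UNIV. partial a (U a b c) x) +
    (1/4) * ((\<Sum>a\<in>UNIV. \<Sum>d\<in>UNIV. U a b d x * T c a d x) + (\<Sum>a\<in>UNIV. \<Sum>d\<in>UNIV. T b d a x * U d a c x))"

text \<open>Each block contributes half the divergence D of \<open>W\<close>: the \<open>x\<close>
  block gives (D + \<open>Q\<close>)/2 - \<open>Q\<close>/2, and the \<open>\<phi>\<close> block
  gives (D - \<open>Q\<close>)/2 + (\<open>Q\<close> + \<open>Q\<close>)/4.\<close>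

lemma scalar_eq_divergence:
  assumes x: "x \<in> V"
  shows "(\<Sum>b\<in>UNIV. \<Sum>c\<in>UNIV. h x $ b $ c * ric_x b c x) + (\<Sum>b\<in>UNIV. \<Sum>c\<in>UNIV. P x $ b $ c * ric_phi b c x) =
    (\<Sum>a\<in>UNIV. partial a (W a) x)"
proof -
  have 1: "(\<Sum>b\<in>UNIV. \<Sum>c\<in>UNIV. h x $ b $ c * (\<Sum>a\<in>UNIV. partial a (T a b c) x)) =
      (\<Sum>a\<in>UNIV. partial a (W a) x) + Q x"
    unfolding sum_rotate_mult using dh_T_trace[OF x] by (simp add: partial_W_T[OF x] sum.distrib)
  have 2: "(\<Sum>b\<in>UNIV. \<Sum>c\<in>UNIV. P x $ b $ c * (\<Sum>a\<in>UNIV. partial a (U a b c) x)) =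
      (\<Sum>a\<in>UNIV. partial a (W a) x) - Q x"
    unfolding sum_rotate_mult by (simp add: partial_W_U[OF x] sum.distrib Q_def)
  have 3: "(\<Sum>b\<in>UNIV. \<Sum>c\<in>UNIV. h x $ b $ c * ric_x b c x) =
     (1/2) * (\<Sum>b\<in>UNIV. \<Sum>c\<in>UNIV. h x $ b $ c * (\<Sum>a\<in>UNIV. partial a (T a b c) x)) -
     (1/2) * (\<Sum>b\<in>UNIV. \<Sum>c\<in>UNIV. h x $ b $ c * (\<Sum>a\<in>UNIV. \<Sum>d\<in>UNIV. T a b d x * T d a c x))"
    unfolding ric_x_def right_diff_distrib sum_subtractf mult.left_commute[of "h x $ _ $ _"]
      sum_distrib_left[symmetric] ..
  have 4: "(\<Sum>b\<in>UNIV. \<Sum>c\<in>UNIV. P x $ b $ c * ric_phi b c x) =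
     (1/2) * (\<Sum>b\<in>UNIV. \<Sum>c\<in>UNIV. P x $ b $ c * (\<Sum>a\<in>UNIV. partial a (U a b c) x)) +
     (1/4) * ((\<Sum>b\<in>UNIV. \<Sum>c\<in>UNIV. P x $ b $ c * (\<Sum>a\<in>UNIV. \<Sum>d\<in>UNIV. U a b d x * T c a d x)) +
       (\<Sum>b\<in>UNIV. \<Sum>c\<in>UNIV. P x $ b $ c * (\<Sum>a\<in>UNIV. \<Sum>d\<in>UNIV. T b d a x * U d a c x)))"
    unfolding ric_phi_def distrib_left sum.distrib mult.left_commute[of "P x $ _ $ _"]
      sum_distrib_left[symmetric] ..
  show ?thesis
    unfolding 3 4 1 2 T_T_trace[OF x] U_T_trace[OF x] T_U_trace[OF x] by (simp add: field_simps)
qed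

section \<open>The divergence of \<open>W\<close> in terms of the determinant of
  \<open>h\<close>\<close>

lemma det_h_diff: "x \<in> V \<Longrightarrow> (\<lambda>x. det (h x)) differentiable at x"
  by (intro differentiable_det h_diff)

lemma partial_det_h:
  "x \<in> V \<Longrightarrow> partial d (\<lambda>x. det (h x)) x = det (h x) * (\<Sum>b\<in>UNIV. \<Sum>c\<in>UNIV. P x $ b $ c * dh d b c x)"
  by (simp add: partial_det[OF h_diff Ph] dh_def mult.commute P_sym)

lemma partial_det_h_diff: "x \<in> V \<Longrightarrow> partial d (\<lambda>x. det (h x)) differentiable at x"
  by (rule differentiable_cong_on[OF _ open_V _ partial_det_h[symmetric]])
     (auto intro!: differentiable_sum differentiable_mult det_h_diff P_diff dh_diff)

text \<open>In Jacobi's formula the factor \<open>h\<close> acts on the differentiation index of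
  \<open>dh\<close>, which produces \<open>- U\<close>; its trace with \<open>P\<close> is
  \<open>W\<close>.\<close>

lemma h_partial_det_h:
  assumes x: "x \<in> V"
  shows "(\<Sum>d\<in>UNIV. h x $ a $ d * partial d (\<lambda>x. det (h x)) x) = - (det (h x) * W a x)"
proof -
  have "(\<Sum>d\<in>UNIV. h x $ a $ d * partial d (\<lambda>x. det (h x)) x) =
    det (h x) * (\<Sum>d\<in>UNIV. h x $ a $ d * (\<Sum>b\<in>UNIV. \<Sum>c\<in>UNIV. P x $ b $ c * dh d b c x))"
    by (simp add: partial_det_h[OF x] sum_distrib_left mult_ac)
  also have "\<dots> = det (h x) * (\<Sum>b\<in>UNIV. \<Sum>c\<in>UNIV. P x $ b $ c * - U a b c x)"
    unfolding sum_mult_swap by (simp add: U_def)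
  finally show ?thesis
    by (simp add: W_eq_U[OF x] sum_negf)
qed

text \<open>\<open>P_U\<close> expresses \<open>dh\<close> by \<open>U\<close>; total symmetry of
  \<open>U\<close> then moves \<open>d\<close> to the front, leaving the trace that defines
  \<open>W\<close> via \<open>W_eq_U\<close>.\<close>

lemma dh_trace:
  assumes x: "x \<in> V"
  shows "(\<Sum>a\<in>UNIV. dh a a d x) = - W d x"
proof -
  have "(\<Sum>a\<in>UNIV. - dh a a d x) = (\<Sum>a\<in>UNIV. \<Sum>e\<in>UNIV. P x $ a $ e * U e a d x)"
    by (simp add: P_U[OF x])
  also have "\<dots> = (\<Sum>a\<in>UNIV. \<Sum>e\<in>UNIV. P x $ a $ e * U d a e x)"
    by (intro sum.cong refl arg_cong2[where f = "(*)"])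
       (metis U_sym[OF x])
  finally show ?thesis
    by (simp add: W_eq_U[OF x] sum_negf)
qed

text \<open>Apply the derivative in direction \<open>a\<close> to \<open>h_partial_det_h\<close> and
  sum over \<open>a\<close>. By \<open>dh_trace\<close> the first-order terms are the same on both
  sides and cancel.\<close>

lemma divergence_eq_det:
  assumes x: "x \<in> V"
  shows "det (h x) * (\<Sum>a\<in>UNIV. partial a (W a) x) =
    - (\<Sum>a\<in>UNIV. \<Sum>d\<in>UNIV. h x $ a $ d * partial a (partial d (\<lambda>x. det (h x))) x)"
proof -
  let ?D = "\<lambda>d. partial d (\<lambda>x. det (h x))"
  have "partial a (\<lambda>x. \<Sum>d\<in>UNIV. h x $ a $ d * ?D d x) x = partial a (\<lambda>x. - (det (h x) * W a x)) x" for a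
    by (rule partial_cong_on[OF open_V x h_partial_det_h])
  then have "(\<Sum>d\<in>UNIV. dh a a d x * ?D d x) + (\<Sum>d\<in>UNIV. h x $ a $ d * partial a (?D d) x) =
      - (?D a x * W a x + det (h x) * partial a (W a) x)" for a
    using x by (simp add: partial_sum partial_mult partial_minus h_diff partial_det_h_diff det_h_diff
        W_diff sum.distrib dh_def)
  then have "(\<Sum>a\<in>UNIV. \<Sum>d\<in>UNIV. dh a a d x * ?D d x) + (\<Sum>a\<in>UNIV. \<Sum>d\<in>UNIV. h x $ a $ d * partial a (?D d) x) =
      - ((\<Sum>a\<in>UNIV. ?D a x * W a x) + det (h x) * (\<Sum>a\<in>UNIV. partial a (W a) x))"
    by (simp add: sum.distrib[symmetric] sum_distrib_left sum_negf[symmetric])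
  moreover have "(\<Sum>a\<in>UNIV. \<Sum>d\<in>UNIV. dh a a d x * ?D d x) = - (\<Sum>a\<in>UNIV. ?D a x * W a x)"
    by (subst sum.swap) (simp add: sum_distrib_right[symmetric] dh_trace[OF x] sum_negf mult.commute)
  ultimately show ?thesis by simp
qed

end

section \<open>Curvature of the block metric\<close>

lemma sum_UNIV_Plus:
  fixes f :: "'a::finite + 'b::finite \<Rightarrow> 'c::comm_monoid_add"
  shows "(\<Sum>i\<in>UNIV. f i) = (\<Sum>a\<in>UNIV. f (Inl a)) + (\<Sum>b\<in>UNIV. f (Inr b))"
  using sum.Plus[of "UNIV :: 'a set" "UNIV :: 'b set" f] by (simp add: UNIV_Plus_UNIV)

lemma block_nth [simp]:
  "block P Q R S $ Inl a $ Inl b = P $ a $ b"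
  "block P Q R S $ Inl a $ Inr b = Q $ a $ b"
  "block P Q R S $ Inr a $ Inl b = R $ a $ b"
  "block P Q R S $ Inr a $ Inr b = S $ a $ b"
  by (simp_all add: block_def)

lemma block_diagonal_mult:
  fixes P S P' S' :: "real^'n::finite^'n"
  shows "block P 0 0 S ** block P' 0 0 S' = block (P ** P') 0 0 (S ** S')"
  by (auto simp: vec_eq_iff split_sum_all matrix_matrix_mult_def sum_UNIV_Plus)

lemma block_mat_1: "block (mat 1) 0 0 (mat 1) = mat 1"
  by (auto simp: vec_eq_iff split_sum_all mat_def)

lemma matrix_inv_eqI:
  fixes A B :: "real^'n::finite^'n"
  assumes "A ** B = mat 1"
  shows "matrix_inv A = B"
proof -
  have "B ** A = mat 1"
    using assms matrix_left_right_inverse by blast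
  then have "matrix_inv A ** A = mat 1"
    unfolding matrix_inv_def using assms by (metis (mono_tags, lifting) someI)
  then show ?thesis
    by (metis assms matrix_mul_assoc matrix_mul_lid matrix_mul_rid)
qed

definition prx :: "real^('n::finite + 'n) \<Rightarrow> real^'n" where
  "prx y = (\<chi> i. y $ Inl i)"

lemma prx_axis [simp]: "prx (axis (Inl a) 1) = axis a 1" "prx (axis (Inr a) 1) = 0"
  by (auto simp: prx_def vec_eq_iff axis_def)

lemma has_derivative_prx: "(prx has_derivative prx) (at y)"
proof -
  have "linear (prx :: real^('n + 'n) \<Rightarrow> real^'n)"
    by (intro linearI) (auto simp: prx_def vec_eq_iff)
  then show ?thesis
    unfolding linear_conv_bounded_linear by (rule bounded_linear_imp_has_derivative)
qed

lemma partial_prx: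
  assumes f: "f differentiable at (prx y)"
  shows "partial (Inl a) (\<lambda>y. f (prx y)) y = partial a f (prx y)"
    and "partial (Inr a) (\<lambda>y. f (prx y)) y = 0"
proof -
  have "((\<lambda>y. f (prx y)) has_derivative (\<lambda>v. frechet_derivative f (at (prx y)) (prx v))) (at y)"
    using has_derivative_compose[OF has_derivative_prx has_derivative_frechet[OF f]] .
  then show "partial (Inl a) (\<lambda>y. f (prx y)) y = partial a f (prx y)"
    and "partial (Inr a) (\<lambda>y. f (prx y)) y = 0"
    using linear_0[OF linear_frechet_derivative[OF f]] by (simp_all add: partial_eqI, simp add: partial_def)
qed

text \<open>\<open>Y\<close> is an open set of full coordinates lying over \<open>V\<close>; on it
  the components \<open>G\<close> depend on the \<open>x\<close> part only.\<close>

locale block_metric = hessian_metric V h P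
  for V :: "(real^'n::finite) set" and h P :: "real^'n \<Rightarrow> real^'n^'n" +
  fixes Y :: "(real^('n + 'n)) set" and G :: "real^('n + 'n) \<Rightarrow> real^('n + 'n)^('n + 'n)"
  assumes open_Y: "open Y"
    and prx_V: "y \<in> Y \<Longrightarrow> prx y \<in> V"
    and G: "y \<in> Y \<Longrightarrow> G y = block (P (prx y)) 0 0 (h (prx y))"
begin

lemma partial_of_prx:
  assumes "y \<in> Y" "\<And>y. y \<in> Y \<Longrightarrow> f y = \<phi> (prx y)" "\<And>x. x \<in> V \<Longrightarrow> \<phi> differentiable at x"
  shows "partial (Inl a) f y = partial a \<phi> (prx y)" "partial (Inr a) f y = 0"
  using partial_cong_on[OF open_Y assms(1), of f "\<lambda>y. \<phi> (prx y)"] assms partial_prx[of \<phi> y a] prx_V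
  by simp_all

lemma inv_G: "y \<in> Y \<Longrightarrow> matrix_inv (G y) = block (h (prx y)) 0 0 (P (prx y))"
  by (rule matrix_inv_eqI) (simp add: G block_diagonal_mult Ph hP prx_V block_mat_1)

lemma partial_G:
  assumes y: "y \<in> Y"
  shows "partial (Inl a) (\<lambda>z. G z $ Inl b $ Inl c) y = dP a b c (prx y)"
    and "partial (Inl a) (\<lambda>z. G z $ Inr b $ Inr c) y = dh a b c (prx y)"
    and "partial k (\<lambda>z. G z $ Inl b $ Inr c) y = 0"
    and "partial k (\<lambda>z. G z $ Inr b $ Inl c) y = 0"
    and "partial (Inr a) (\<lambda>z. G z $ i $ j) y = 0"
proof -
  note P = partial_of_prx[OF y, of "\<lambda>z. G z $ Inl b $ Inl c" "\<lambda>x. P x $ b $ c" for b c, OF _ P_diff]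
  note h = partial_of_prx[OF y, of "\<lambda>z. G z $ Inr b $ Inr c" "\<lambda>x. h x $ b $ c" for b c, OF _ h_diff]
  show "partial (Inl a) (\<lambda>z. G z $ Inl b $ Inl c) y = dP a b c (prx y)"
    and "partial (Inl a) (\<lambda>z. G z $ Inr b $ Inr c) y = dh a b c (prx y)"
    by (simp_all add: P h G dP_def dh_def)
  show 0: "partial k (\<lambda>z. G z $ Inl b $ Inr c) y = 0" "partial k (\<lambda>z. G z $ Inr b $ Inl c) y = 0" for b c k
    using partial_cong_on[OF open_Y y, of "\<lambda>z. G z $ Inl b $ Inr c" "\<lambda>_. 0"]
      partial_cong_on[OF open_Y y, of "\<lambda>z. G z $ Inr b $ Inl c" "\<lambda>_. 0"]
    by (simp_all add: G)
  show "partial (Inr a) (\<lambda>z. G z $ i $ j) y = 0"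
    by (cases i; cases j) (simp_all add: 0 P h G)
qed

lemma christoffel_G:
  assumes y: "y \<in> Y"
  shows "christoffel G (Inl c) (Inl a) (Inl b) y = (1/2) * T c a b (prx y)"
    and "christoffel G (Inl c) (Inr a) (Inr b) y = (1/2) * U c a b (prx y)"
    and "christoffel G (Inr c) (Inl a) (Inr b) y = - (1/2) * T b a c (prx y)"
    and "christoffel G (Inr c) (Inr b) (Inl a) y = - (1/2) * T b a c (prx y)"
    and "christoffel G (Inl c) (Inl a) (Inr b) y = 0"
    and "christoffel G (Inl c) (Inr a) (Inl b) y = 0"
    and "christoffel G (Inr c) (Inl a) (Inl b) y = 0"
    and "christoffel G (Inr c) (Inr a) (Inr b) y = 0"
proof -
  note x = prx_V[OF y]
  \<comment> \<open>Total symmetry of \<open>dP\<close> collapses the three terms of the Christoffel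
    formula to one.\<close>
  have "dP a b d (prx y) + dP b a d (prx y) - dP d a b (prx y) = dP d a b (prx y)" for d
    using dP_sym[OF x] by (metis add_diff_cancel_right')
  then show "christoffel G (Inl c) (Inl a) (Inl b) y = (1/2) * T c a b (prx y)"
    by (simp add: christoffel_def sum_UNIV_Plus inv_G partial_G y T_def)
  \<comment> \<open>In a mixed symbol only the \<open>x\<close> derivative of the block
    \<open>h\<close> survives, contracted with the inverse block \<open>P\<close>.\<close>
  have *: "(\<Sum>d\<in>UNIV. P (prx y) $ c $ d * dh a b d (prx y)) = - T b a c (prx y)"
    using P_dh_T[OF x, of c a b] by (simp add: dh_sym[OF x, of a b])
  show "christoffel G (Inr c) (Inl a) (Inr b) y = - (1/2) * T b a c (prx y)"
    and "christoffel G (Inr c) (Inr b) (Inl a) y = - (1/2) * T b a c (prx y)"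
    by (simp_all add: christoffel_def sum_UNIV_Plus inv_G partial_G y *)
qed (simp_all add: christoffel_def sum_UNIV_Plus inv_G partial_G y U_def sum_negf)

lemma partial_christoffel_G:
  assumes y: "y \<in> Y"
  shows "partial (Inl d) (christoffel G (Inl c) (Inl a) (Inl b)) y = (1/2) * partial d (T c a b) (prx y)"
    and "partial (Inl d) (christoffel G (Inl c) (Inr a) (Inr b)) y = (1/2) * partial d (U c a b) (prx y)"
    and "partial (Inl d) (christoffel G (Inr c) (Inr b) (Inl a)) y = - (1/2) * partial d (T b a c) (prx y)"
    and "partial (Inr d) (christoffel G k i j) y = 0"
proof -
  note 1 = partial_of_prx[OF y, of _ "\<lambda>x. (1/2) * T c a b x" for a b c, OF christoffel_G(1)]
  note 2 = partial_of_prx[OF y, of _ "\<lambda>x. (1/2) * U c a b x" for a b c, OF christoffel_G(2)]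
  note 3 = partial_of_prx[OF y, of _ "\<lambda>x. - (1/2) * T b a c x" for a b c, OF christoffel_G(3)]
  note 4 = partial_of_prx[OF y, of _ "\<lambda>x. - (1/2) * T b a c x" for a b c, OF christoffel_G(4)]
  \<comment> \<open>Vanishing symbols are treated as pullbacks of the constant 0.\<close>
  note 0 = partial_of_prx(2)[OF y, of _ "\<lambda>_. 0"]
  note d = T_diff U_diff prx_V[OF y]
  show "partial (Inl d) (christoffel G (Inl c) (Inl a) (Inl b)) y = (1/2) * partial d (T c a b) (prx y)"
    by (simp add: 1 d partial_divide_const partial_minus)
  show "partial (Inl d) (christoffel G (Inl c) (Inr a) (Inr b)) y = (1/2) * partial d (U c a b) (prx y)"
    by (simp add: 2 d partial_divide_const partial_minus)
  show "partial (Inl d) (christoffel G (Inr c) (Inr b) (Inl a)) y = - (1/2) * partial d (T b a c) (prx y)"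
    by (simp add: 4 d partial_divide_const partial_minus)
  show "partial (Inr d) (christoffel G k i j) y = 0"
    by (cases k; cases i; cases j) (simp_all add: 1 2 3 4 d 0 christoffel_G)
qed

lemma ricci_G:
  assumes y: "y \<in> Y"
  shows "ricci G (Inl b) (Inl c) y = ric_x b c (prx y)"
    and "ricci G (Inr b) (Inr c) y = ric_phi b c (prx y)"
proof -
  note x = prx_V[OF y]
  let ?x = "prx y"
  note simps = riemann_def sum_UNIV_Plus christoffel_G[OF y] partial_christoffel_G[OF y]
  have pT: "partial d (T a b c) ?x = partial d (T a c b) ?x" for a b c d
    by (rule partial_cong_on[OF open_V x T_sym])
  \<comment> \<open>The contraction index runs over pairs \<open>Inl a\<close>,
    \<open>Inr a\<close>, because the trace terms \<open>T a a d\<close> and the derivatives of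
    \<open>T a a c\<close> cancel within each pair.\<close>
  have 1: "riemann G (Inl a) (Inl c) (Inl a) (Inl b) y + riemann G (Inr a) (Inl c) (Inr a) (Inl b) y =
    (1/2) * partial a (T a b c) ?x - (1/4) * (\<Sum>d\<in>UNIV. T a b d ?x * T d a c ?x)
     - (1/4) * (\<Sum>d\<in>UNIV. T d b a ?x * T a c d ?x)" for a
    by (simp add: simps pT[of b a a c] T_sym[OF x, of a _ a] sum_subtractf sum_negf sum_distrib_left)
  \<comment> \<open>The two quadratic sums agree after relabelling, so their coefficients 1/4 add up
    to the 1/2 in \<open>ric_x\<close>.\<close>
  have "(\<Sum>a\<in>UNIV. \<Sum>d\<in>UNIV. T d b a ?x * T a c d ?x) = (\<Sum>a\<in>UNIV. \<Sum>d\<in>UNIV. T a b d ?x * T d a c ?x)"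
    by (subst sum.swap) (simp add: T_sym[OF x, of _ c])
  then show "ricci G (Inl b) (Inl c) y = ric_x b c ?x"
    by (simp add: ricci_def sum_UNIV_Plus[of "\<lambda>i. riemann G i _ i _ y"] sum.distrib[symmetric] 1 ric_x_def)
       (simp add: sum_subtractf sum_divide_distrib[symmetric])
  \<comment> \<open>The same pairing removes the traces of \<open>T\<close> multiplied by
    \<open>U\<close>.\<close>
  have 2: "riemann G (Inl a) (Inr c) (Inl a) (Inr b) y + riemann G (Inr a) (Inr c) (Inr a) (Inr b) y =
    (1/2) * partial a (U a b c) ?x + (1/4) * (\<Sum>d\<in>UNIV. U a b d ?x * T c a d ?x)
     + (1/4) * (\<Sum>d\<in>UNIV. T b d a ?x * U d a c ?x)" for a
    by (simp add: simps T_sym[OF x, of a _ a] sum.distrib sum_subtractf sum_negf sum_distrib_left)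
  show "ricci G (Inr b) (Inr c) y = ric_phi b c ?x"
    by (simp add: ricci_def sum_UNIV_Plus[of "\<lambda>i. riemann G i _ i _ y"] sum.distrib[symmetric] 2 ric_phi_def)
       (simp add: sum.distrib sum_divide_distrib[symmetric])
qed

text \<open>The inverse metric is block diagonal, so only the two diagonal Ricci blocks enter the
  trace; \<open>det h\<close> is nonzero and can be divided out.\<close>

lemma scalar_curvature_coords_G:
  assumes y: "y \<in> Y"
  shows "scalar_curvature_coords G y = - (1 / det (h (prx y))) *
    (\<Sum>a\<in>UNIV. \<Sum>d\<in>UNIV. h (prx y) $ a $ d * partial a (partial d (\<lambda>x. det (h x))) (prx y))"
proof -
  note x = prx_V[OF y]
  have "det (h (prx y)) \<noteq> 0"
    using hP[OF x] by (metis det_I det_mul mult_zero_left zero_neq_one)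
  moreover have "scalar_curvature_coords G y = (\<Sum>a\<in>UNIV. partial a (W a) (prx y))"
    by (simp add: scalar_curvature_coords_def sum_UNIV_Plus inv_G[OF y] ricci_G[OF y]
        scalar_eq_divergence[OF x])
  ultimately show ?thesis
    using divergence_eq_det[OF x] by (simp add: field_simps)
qed

end

section \<open>Symplectic coordinates\<close>

lemma smooth_on_differentiable: "smooth_on S f \<Longrightarrow> x \<in> S \<Longrightarrow> f differentiable at x"
  unfolding smooth_on_def by (drule spec[of _ 1]) simp

lemma smooth_on_continuous: "smooth_on S f \<Longrightarrow> continuous_on S f"
  unfolding smooth_on_def by (drule spec[of _ 0]) simp

lemma smooth_on_partial: "smooth_on S f \<Longrightarrow> smooth_on S (partial i f)"
  unfolding smooth_on_def partial_def[abs_def]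
proof
  fix k assume "\<forall>k. Ck_on k S f"
  then have "Ck_on (Suc k) S f" ..
  then show "Ck_on k S (\<lambda>x. frechet_derivative f (at x) (axis i 1))" by simp
qed

section \<open>From the symplectic potential to the Hessian metric\<close>

lemma pos_definite_matrix_inv:
  fixes M :: "real^'n::finite^'n"
  assumes "pos_definite M"
  shows "M ** matrix_inv M = mat 1"
proof -
  have "v = 0" if "M *v v = 0" for v
    using assms that unfolding pos_definite_def by force
  then obtain B where "B ** M = mat 1"
    using matrix_left_invertible_ker by blast
  then have B: "M ** B = mat 1"
    using matrix_left_right_inverse by blast
  then show ?thesis
    by (simp add: matrix_inv_eqI)
qed

lemma symmetric_mat_matrix_inv:
  fixes M :: "real^'n::finite^'n"
  assumes "symmetric_mat M" "M ** matrix_inv M = mat 1"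
  shows "symmetric_mat (matrix_inv M)"
proof -
  have "transpose (M ** matrix_inv M) = transpose (mat 1)"
    by (simp only: assms(2))
  then have "transpose (matrix_inv M) ** M = mat 1"
    using assms(1) by (simp add: matrix_transpose_mul symmetric_mat_def transpose_mat)
  then have "M ** transpose (matrix_inv M) = mat 1"
    using matrix_left_right_inverse by blast
  then show ?thesis
    unfolding symmetric_mat_def by (rule matrix_inv_eqI[symmetric])
qed

lemma symmetric_mat_nth: "symmetric_mat M \<Longrightarrow> M $ i $ j = M $ j $ i"
  unfolding symmetric_mat_def by (drule arg_cong[of _ _ "\<lambda>M. M $ j $ i"]) (simp add: transpose_def)

text \<open>Surjective linear maps are open. This makes the set of \<open>x\<close> values of a
  chart open, as two-sided derivatives demand.\<close>

lemma open_prx_image: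
  assumes "open S"
  shows "open (prx ` S)"
proof (rule open_surjective_linear_image[OF assms])
  show "linear (prx :: real^('n + 'n) \<Rightarrow> real^'n)"
    by (intro linearI) (auto simp: prx_def vec_eq_iff)
  have "prx (\<chi> i. case i of Inl a \<Rightarrow> x $ a | Inr b \<Rightarrow> 0) = x" for x :: "real^'n"
    by (simp add: prx_def vec_eq_iff)
  then show "surj (prx :: real^('n + 'n) \<Rightarrow> real^'n)"
    by (rule surjI)
qed

text \<open>The entries of the inverse of \<open>h\<close> are second partials of the smooth
  \<open>\<Phi>\<close>, so their regularity is that of higher partials of
  \<open>\<Phi>\<close>.\<close>

lemma hessian_metricI:
  fixes h :: "real^'n::finite \<Rightarrow> real^'n^'n"
  assumes V: "open V"
    and h: "\<And>x. x \<in> V \<Longrightarrow> symmetric_mat (h x) \<and> pos_definite (h x)"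
    and \<Phi>: "smooth_on V \<Phi>"
    and hess: "\<And>x i j. x \<in> V \<Longrightarrow> matrix_inv (h x) $ i $ j = partial i (partial j \<Phi>) x"
  shows "hessian_metric V h (\<lambda>x. matrix_inv (h x))"
proof -
  let ?P = "\<lambda>x. matrix_inv (h x)"
  have hP: "h x ** ?P x = mat 1" if "x \<in> V" for x
    by (rule pos_definite_matrix_inv[OF conjunct2[OF h[OF that]]])
  have d3: "partial a (\<lambda>x. ?P x $ b $ c) x = partial a (partial b (partial c \<Phi>)) x" if "x \<in> V" for a b c x
    by (rule partial_cong_on[OF V that hess])
  show ?thesis
  proof
    show "open V" by fact
    fix x a b c assume x: "x \<in> V"
    show "h x $ b $ c = h x $ c $ b"
      by (rule symmetric_mat_nth[OF conjunct1[OF h[OF x]]])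
    show "?P x $ b $ c = ?P x $ c $ b"
      by (rule symmetric_mat_nth[OF symmetric_mat_matrix_inv[OF conjunct1[OF h[OF x]] hP[OF x]]])
    show "h x ** ?P x = mat 1" by (rule hP[OF x])
    show "(\<lambda>x. ?P x $ b $ c) differentiable at x"
      by (rule differentiable_cong_on[OF _ V x, of "partial b (partial c \<Phi>)"],
         intro smooth_on_differentiable[OF _ x] smooth_on_partial \<Phi>, simp add: hess)
    show "partial a (\<lambda>x. ?P x $ b $ c) differentiable at x"
      by (rule differentiable_cong_on[OF _ V x, of "partial a (partial b (partial c \<Phi>))"],
         intro smooth_on_differentiable[OF _ x] smooth_on_partial \<Phi>, simp add: d3)
    \<comment> \<open>Symmetry of second partials, applied to the function
      \<open>partial c \<Phi>\<close>.\<close>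
    show "partial a (\<lambda>x. ?P x $ b $ c) x = partial b (\<lambda>x. ?P x $ a $ c) x"
      unfolding d3[OF x]
      by (rule partial_commute[OF V x])
         (erule smooth_on_differentiable[rotated] | rule smooth_on_continuous smooth_on_partial \<Phi>)+
  qed
qed

theorem theorem5p5:
  fixes X :: "'m topology"
    and A :: "('m, 'n::finite + 'n) chart set"
    and g J \<omega> :: "('m, 'n + 'n) tensor2"
    and act :: "real^'n \<Rightarrow> 'm \<Rightarrow> 'm"
    and \<mu> :: "'m \<Rightarrow> real^'n"
    and c :: "('m, 'n + 'n) chart"
    and h :: "real^'n \<Rightarrow> real^'n^'n"
    and \<Phi> :: "real^'n \<Rightarrow> real"
    and p :: 'm
  assumes "kahler_toric_manifold X A g J \<omega> act \<mu>"
    and "symplectic_coordinates X A g \<omega> act \<mu> c h \<Phi>"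
    and "p \<in> chart_dom c"
  shows "scalar_curvature g c p =
           - (1 / det (h (coord_x c p))) *
             (\<Sum>i\<in>UNIV. \<Sum>j\<in>UNIV. h (coord_x c p) $ i $ j *
                partial i (partial j (\<lambda>x. det (h x))) (coord_x c p))"
proof -
  interpret kahler_toric_manifold X A g J \<omega> act \<mu> by fact
  let ?V = "coord_x c ` chart_dom c"
  have c: "c \<in> A"
    and g: "\<And>q. q \<in> chart_dom c \<Longrightarrow> g c q = block (matrix_inv (h (coord_x c q))) 0 0 (h (coord_x c q))"
    and h: "\<And>x. x \<in> ?V \<Longrightarrow> symmetric_mat (h x) \<and> pos_definite (h x)"
    and \<Phi>: "smooth_on ?V \<Phi>"
    and hess: "\<And>x i j. x \<in> ?V \<Longrightarrow> matrix_inv (h x) $ i $ j = partial i (partial j \<Phi>) x"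
    using assms(2) unfolding symplectic_coordinates_def by blast+
  have prx: "coord_x c q = prx (chart_map c q)" for q
    by (simp add: coord_x_def prx_def)
  have open_Y: "open (chart_image c)"
    using charts[OF c] by (simp add: is_chart_def)
  have V: "?V = prx ` chart_image c"
    by (simp add: chart_image_def image_image prx)
  have inv: "chart_inv c y \<in> chart_dom c" "chart_map c (chart_inv c y) = y" if "y \<in> chart_image c" for y
    using that unfolding chart_image_def chart_inv_def by (simp_all add: inv_into_into f_inv_into_f)
  have "open ?V"
    unfolding V by (rule open_prx_image[OF open_Y])
  then interpret hessian_metric ?V h "\<lambda>x. matrix_inv (h x)"
    using h \<Phi> hess by (rule hessian_metricI)
  \<comment> \<open>Here \<open>Y\<close> is the image of the chart and \<open>G\<close> the
    component matrix of the metric as a function of the coordinates, which is the form in which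
    \<open>scalar_curvature\<close> evaluates it.\<close>
  interpret block_metric ?V h "\<lambda>x. matrix_inv (h x)" "chart_image c" "\<lambda>y. g c (chart_inv c y)"
    by unfold_locales (use open_Y V inv in \<open>auto simp: g prx\<close>)
  show ?thesis
    using scalar_curvature_coords_G[of "chart_map c p"] assms(3)
    by (simp add: scalar_curvature_def prx chart_image_def)
qed

end
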